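(* Let $m=2m_0+1$ be odd, $n\ge2$, $\mathcal{H}\in\operatorname{H}^m(\mathbb{C}^n)$ with associated vector $h=(h_0,\dots,h_d)$, $d=(n-1)m$, $s=\lfloor d/2\rfloor$, $r=\operatorname{rank}C_{d-s,s}(h)$, and let $0\ne(f_0,\dots,f_r)\in\ker C_{d-r,r}(h)$ (unique up to scaling), $f(x,y)=f_0x^r+f_1x^{r-1}y+\cdots+f_ry^r$. Suppose $r\le 1+(n-1)m_0$. (i) If $f$ has no multiple roots, then $\operatorname{rank}_V(\mathcal{H})=\operatorname{rank}_S(\mathcal{H})=\operatorname{rank}(\mathcal{H})=\underline{\operatorname{rank}}_V(\mathcal{H})=\underline{\operatorname{rank}}_S(\mathcal{H})=\underline{\operatorname{rank}}(\mathcal{H})=r.$ (ii) If $f$ has a multiple root, then $d-r+2=\operatorname{rank}_V(\mathcal{H})\ge\operatorname{rank}_S(\mathcal{H})\ge\underline{\operatorname{rank}}_V(\mathcal{H})=\underline{\operatorname{rank}}_S(\mathcal{H})=\underline{\operatorname{rank}}(\mathcal{H})=r.$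
   Context: A tensor $\mathcal{H}\in\operatorname{T}^m(\mathbb{C}^n)$ is Hankel if there is a vector $h=(h_0,\dots,h_{(n-1)m})$ (associated vector) with $\mathcal{H}_{i_1\dots i_m}=h_{i_1+\cdots+i_m-m}$; $\operatorname{H}^m(\mathbb{C}^n)$ is the space of such tensors. $C_{d-r,r}(h)$ is the $(d-r+1)\times(r+1)$ matrix with $(i,j)$ entry $h_{i+j}$. Ranks: cp rank $\operatorname{rank}(\mathcal{A})$ = least $r$ with $\mathcal{A}=\sum_{i=1}^r u_{i,1}\otimes\cdots\otimes u_{i,m}$; border rank $\underline{\operatorname{rank}}(\mathcal{A})$ = least $r$ such that $\mathcal{A}$ is a limit of such sums of $r$ terms; symmetric rank $\operatorname{rank}_S$ and symmetric border rank $\underline{\operatorname{rank}}_S$ are defined the same way with terms $u_i^{\otimes m}$; Vandermonde rank $\operatorname{rank}_V(\mathcal{H})$ = least $r$ with $\mathcal{H}=\sum_{i=1}^r(a_i^{n-1},a_i^{n-2}b_i,\dots,b_i^{n-1})^{\otimes m}$, $a_i,b_i\in\mathbb{C}$; Vandermonde border rank $\underline{\operatorname{rank}}_V(\mathcal{H})$ = least $r$ such that $\mathcal{H}$ is a limit of Hankel tensors of Vandermonde rank at most $r$. *)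

theory Defs
  imports Complex_Main "Jordan_Normal_Form.DL_Rank" "Jordan_Normal_Form.Matrix_Kernel"
begin

text \<open>Tensors of order m over C^n are represented as functions from index maps
  i :: nat => nat to complex numbers (indices 0-based); only the values on the
  finite set idx m n of admissible index maps matter.\<close>

definition idx :: "nat \<Rightarrow> nat \<Rightarrow> (nat \<Rightarrow> nat) set" where
  "idx m n = {i. (\<forall>k<m. i k < n) \<and> (\<forall>k\<ge>m. i k = 0)}"

type_synonym tensor = "(nat \<Rightarrow> nat) \<Rightarrow> complex"

definition hankel_tensor :: "nat \<Rightarrow> (nat \<Rightarrow> complex) \<Rightarrow> tensor" where
  "hankel_tensor m h = (\<lambda>i. h (\<Sum>k<m. i k))"

definition catalecticant :: "nat \<Rightarrow> nat \<Rightarrow> (nat \<Rightarrow> complex) \<Rightarrow> complex mat" where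
  "catalecticant p q h = mat (p + 1) (q + 1) (\<lambda>(i, j). h (i + j))"

definition mat_rank :: "complex mat \<Rightarrow> nat" where
  "mat_rank A = vec_space.rank (dim_row A) A"

text \<open>Decompositions with exactly r terms (zero terms allowed, so this means "at most r").\<close>
definition cp_decomp :: "nat \<Rightarrow> nat \<Rightarrow> tensor \<Rightarrow> nat \<Rightarrow> bool" where
  "cp_decomp m n A r \<longleftrightarrow> (\<exists>u :: nat \<Rightarrow> nat \<Rightarrow> nat \<Rightarrow> complex.
     \<forall>i\<in>idx m n. A i = (\<Sum>j<r. \<Prod>k<m. u j k (i k)))"

definition sym_decomp :: "nat \<Rightarrow> nat \<Rightarrow> tensor \<Rightarrow> nat \<Rightarrow> bool" where
  "sym_decomp m n A r \<longleftrightarrow> (\<exists>v :: nat \<Rightarrow> nat \<Rightarrow> complex.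
     \<forall>i\<in>idx m n. A i = (\<Sum>j<r. \<Prod>k<m. v j (i k)))"

definition vand_decomp :: "nat \<Rightarrow> nat \<Rightarrow> tensor \<Rightarrow> nat \<Rightarrow> bool" where
  "vand_decomp m n A r \<longleftrightarrow> (\<exists>a b :: nat \<Rightarrow> complex.
     \<forall>i\<in>idx m n. A i = (\<Sum>j<r. \<Prod>k<m. a j ^ (n - 1 - i k) * b j ^ (i k)))"

definition tensor_limit :: "nat \<Rightarrow> nat \<Rightarrow> (nat \<Rightarrow> tensor) \<Rightarrow> tensor \<Rightarrow> bool" where
  "tensor_limit m n X A \<longleftrightarrow> (\<forall>i\<in>idx m n. (\<lambda>t. X t i) \<longlonglongrightarrow> A i)"

definition cp_rank :: "nat \<Rightarrow> nat \<Rightarrow> tensor \<Rightarrow> nat" where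
  "cp_rank m n A = (LEAST r. cp_decomp m n A r)"

definition sym_rank :: "nat \<Rightarrow> nat \<Rightarrow> tensor \<Rightarrow> nat" where
  "sym_rank m n A = (LEAST r. sym_decomp m n A r)"

definition vand_rank :: "nat \<Rightarrow> nat \<Rightarrow> tensor \<Rightarrow> nat" where
  "vand_rank m n A = (LEAST r. vand_decomp m n A r)"

definition border_rank :: "nat \<Rightarrow> nat \<Rightarrow> tensor \<Rightarrow> nat" where
  "border_rank m n A = (LEAST r. \<exists>X. (\<forall>t. cp_decomp m n (X t) r) \<and> tensor_limit m n X A)"

definition sym_border_rank :: "nat \<Rightarrow> nat \<Rightarrow> tensor \<Rightarrow> nat" where
  "sym_border_rank m n A = (LEAST r. \<exists>X. (\<forall>t. sym_decomp m n (X t) r) \<and> tensor_limit m n X A)"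

text \<open>Limit of Hankel tensors of Vandermonde rank at most r (such tensors are exactly
  the sums of r Vandermonde terms, which are automatically Hankel).\<close>
definition vand_border_rank :: "nat \<Rightarrow> nat \<Rightarrow> tensor \<Rightarrow> nat" where
  "vand_border_rank m n A = (LEAST r. \<exists>X. (\<forall>t. (\<exists>h. \<forall>i\<in>idx m n. X t i = hankel_tensor m h i)
        \<and> vand_rank m n (X t) \<le> r) \<and> tensor_limit m n X A)"

definition binform_multiple_root :: "nat \<Rightarrow> (nat \<Rightarrow> complex) \<Rightarrow> bool" where
  "binform_multiple_root r f \<longleftrightarrow> 2 \<le> r \<and> (\<exists>a b g. (a, b) \<noteq> (0, 0) \<and>
     (\<forall>x y. (\<Sum>j\<le>r. f j * x ^ (r - j) * y ^ j)
        = (b * x - a * y)^2 * (\<Sum>j\<le>r - 2. g j * x ^ (r - 2 - j) * y ^ j)))"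

end

(* A binary form p = sum p_j x^(r-j) y^j acts on sequences by (p.h)_i = sum_j p_j h_(i+j), so that
   products of forms act by composition, and p maps the sequence of the point (a,b), a^(d-t) b^t,
   to p(a,b) times the corresponding sequence of degree d - r.  The kernel of C_(d-r,r)(h) is the
   space of forms of degree r annihilating h.

   Upper bounds.  If a product of r pairwise independent linear forms annihilates h, peeling off one
   linear factor at a time writes h as a combination of the r corresponding points.  If the factors
   repeat, the same recursion solved with slightly perturbed factors shows that h is a limit of such
   combinations.

   Multiple root.  Since no nonzero form of degree r - 1 annihilates h, the annihilators of degree
   d - r + 2 have no common zero; a general member of a pencil of them is squarefree by a Wronskian
   argument.  Conversely, on a shortest representation with at most d - r + 1 points f must vanish at
   all points, so there are exactly r of them and f is squarefree.

   Lower bounds.  Flattening a tensor of border rank rho (m0 against m0 + 1 factors) gives a limit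
   of matrices of rank at most rho, while the flattening of the Hankel tensor contains a
   catalecticant.  Its rank is still r: a nonzero space of annihilators gains at least one dimension,
   measured by the set of degrees of its members, whenever the degree is raised by one. *)

theory Submission
  imports Defs "HOL-Computational_Algebra.Fundamental_Theorem_Algebra"
begin

section \<open>Binary forms acting on sequences\<close>

text \<open>This is \<open>p\<close> evaluated at the shift operator and applied to
  \<open>h\<close>. It depends on the polynomial alone, whatever nominal degree it is given as a
  form.\<close>

definition act :: "complex poly \<Rightarrow> (nat \<Rightarrow> complex) \<Rightarrow> nat \<Rightarrow> complex" where
  "act p h i = (\<Sum>j\<le>degree p. coeff p j * h (i + j))"

lemma act_bound:
  assumes "degree p \<le> N"
  shows "act p h i = (\<Sum>j\<le>N. coeff p j * h (i + j))"
  unfolding act_def using assms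
  by (intro sum.mono_neutral_left) (auto simp: coeff_eq_0)

lemma act_0 [simp]: "act 0 h i = 0"
  by (simp add: act_def)

lemma act_1 [simp]: "act 1 h i = h i"
  by (simp add: act_def)

lemma act_pCons: "act (pCons c p) h i = c * h i + act p h (Suc i)"
proof -
  have "act (pCons c p) h i = (\<Sum>j\<le>Suc (degree p). coeff (pCons c p) j * h (i + j))"
    by (rule act_bound) (rule degree_pCons_le)
  also have "\<dots> = c * h i + act p h (Suc i)"
    by (subst sum.atMost_Suc_shift) (simp add: act_def)
  finally show ?thesis .
qed

lemma act_add: "act (p + q) h i = act p h i + act q h i"
  by (simp add: act_bound[of _ "max (degree p) (degree q)"] degree_add_le_max
      sum.distrib distrib_right)

lemma act_smult: "act (smult c p) h i = c * act p h i"
  by (simp add: act_bound[of _ "degree p"] degree_smult_le sum_distrib_left mult.assoc)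

lemma act_mult: "act (p * q) h i = act p (act q h) i"
proof (induction p arbitrary: i)
  case (pCons c p)
  have "act (pCons c p * q) h i = c * act q h i + act (pCons 0 (p * q)) h i"
    by (simp add: mult_pCons_left act_add act_smult)
  then show ?case by (simp add: act_pCons pCons.IH)
qed simp

lemma act_cong:
  assumes "degree p \<le> N" "\<And>j. j \<le> N \<Longrightarrow> h (i + j) = h' (i + j)"
  shows "act p h i = act p h' i"
  using assms by (simp add: act_bound)

lemma act_sum: "act p (\<lambda>t. \<Sum>j\<in>J. c j * g j t) i = (\<Sum>j\<in>J. c j * act p (g j) i)"
  unfolding act_def sum_distrib_left by (subst sum.swap) (simp add: mult_ac)

definition vm :: "nat \<Rightarrow> complex \<Rightarrow> complex \<Rightarrow> nat \<Rightarrow> complex" where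
  "vm d a b t = a ^ (d - t) * b ^ t"

text \<open>Polynomials stand for binary forms of a nominal degree \<open>r\<close>; if the degree of the polynomial is
  smaller, the form has a zero at the point \<open>(0, 1)\<close>.\<close>

definition form :: "nat \<Rightarrow> complex poly \<Rightarrow> complex \<Rightarrow> complex \<Rightarrow> complex" where
  "form r p x y = (\<Sum>j\<le>r. coeff p j * x ^ (r - j) * y ^ j)"

text \<open>The linear form with zero \<open>(a, b)\<close>, namely \<open>b x - a y\<close>.\<close>

definition lin :: "complex \<Rightarrow> complex \<Rightarrow> complex poly" where
  "lin a b = [:b, - a:]"

text \<open>For \<open>r \<le> d\<close> this says that the coefficient vector lies in the kernel of
  \<open>catalecticant (d - r) r h\<close>. For \<open>r > d\<close> there are no equations left and
  only the degree bound remains.\<close>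

definition annih :: "nat \<Rightarrow> nat \<Rightarrow> complex poly \<Rightarrow> (nat \<Rightarrow> complex) \<Rightarrow> bool" where
  "annih d r p h \<longleftrightarrow> degree p \<le> r \<and> (\<forall>i. i + r \<le> d \<longrightarrow> act p h i = 0)"

text \<open>The points are pairwise distinct on the projective line.\<close>

definition gen_pos :: "nat \<Rightarrow> (nat \<Rightarrow> complex) \<Rightarrow> (nat \<Rightarrow> complex) \<Rightarrow> bool" where
  "gen_pos r a b \<longleftrightarrow> (\<forall>j<r. (a j, b j) \<noteq> (0, 0)) \<and>
     (\<forall>j<r. \<forall>k<r. j \<noteq> k \<longrightarrow> a j * b k \<noteq> a k * b j)"

lemma act_vm:
  assumes "degree p \<le> r" "i + r \<le> d"
  shows "act p (vm d a b) i = form r p a b * vm (d - r) a b i"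
proof -
  have "act p (vm d a b) i = (\<Sum>j\<le>r. coeff p j * vm d a b (i + j))"
    using assms by (simp add: act_bound)
  also have "\<dots> = (\<Sum>j\<le>r. coeff p j * a ^ (r - j) * b ^ j * (a ^ (d - r - i) * b ^ i))"
  proof (rule sum.cong[OF refl])
    fix j assume "j \<in> {..r}"
    then have "d - (i + j) = (r - j) + (d - r - i)" using assms by auto
    then show "coeff p j * vm d a b (i + j) = coeff p j * a ^ (r - j) * b ^ j * (a ^ (d - r - i) * b ^ i)"
      by (simp add: vm_def power_add mult_ac)
  qed
  finally show ?thesis by (simp add: form_def vm_def sum_distrib_right)
qed

lemma form_eq_act: "degree p \<le> r \<Longrightarrow> form r p x y = act p (vm r x y) 0"
  by (simp add: act_vm vm_def)

text \<open>Evaluation at a point is the action on the sequence of that point, so multiplicativity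
  follows from composition of actions, without convolving coefficients.\<close>

lemma form_mult:
  assumes "degree p \<le> r" "degree q \<le> s"
  shows "form (r + s) (p * q) x y = form r p x y * form s q x y"
proof -
  have "form (r + s) (p * q) x y = act p (act q (vm (r + s) x y)) 0"
    using assms by (subst form_eq_act) (auto intro: order.trans[OF degree_mult_le] simp: act_mult)
  \<comment> \<open>The sum over a single index puts a scalar multiple into the shape that
    \<open>act_sum\<close> expects.\<close>
  also have "\<dots> = act p (\<lambda>i. \<Sum>j<Suc 0. form s q x y * vm r x y i) 0"
    using assms by (intro act_cong[of _ r]) (auto simp: act_vm)
  also have "\<dots> = form s q x y * act p (vm r x y) 0"
    by (subst act_sum) simp
  finally show ?thesis using assms by (simp add: form_eq_act)
qed

lemma degree_lin_le: "degree (lin a b) \<le> 1"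
  by (simp add: lin_def)

lemma lin_eq_0_iff [simp]: "lin a b = 0 \<longleftrightarrow> a = 0 \<and> b = 0"
  by (auto simp: lin_def)

lemma form_lin: "form (Suc 0) (lin a b) x y = b * x - a * y"
  by (simp add: form_def lin_def)

lemma act_lin: "act (lin a b) h i = b * h i - a * h (Suc i)"
  by (simp add: lin_def act_pCons)

lemma form_smult: "form r (smult c p) x y = c * form r p x y"
  by (simp add: form_def sum_distrib_left mult.assoc)

lemma form_add: "form r (p + q) x y = form r p x y + form r q x y"
  by (simp add: form_def sum.distrib algebra_simps)

lemma form_1: "degree p \<le> r \<Longrightarrow> form r p 1 y = poly p y"
  unfolding form_def poly_altdef
  by (simp, intro sum.mono_neutral_right) (auto simp: coeff_eq_0)

lemma form_0: "form r p 0 y = coeff p r * y ^ r"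
proof -
  have "form r p 0 y = (\<Sum>j\<in>{r}. coeff p j * 0 ^ (r - j) * y ^ j)"
    unfolding form_def by (intro sum.mono_neutral_right) auto
  then show ?thesis by simp
qed

lemma form_affine:
  assumes "degree p \<le> r" "x \<noteq> 0"
  shows "form r p x y = x ^ r * poly p (y / x)"
proof -
  have "form r p x y = x ^ r * form r p 1 (y / x)"
    unfolding form_def sum_distrib_left
    by (intro sum.cong) (auto simp: field_simps power_diff assms)
  then show ?thesis using assms by (simp add: form_1)
qed

section \<open>Zeros of binary forms and factorization into linear forms\<close>

lemma degree_prod_lin_le: "finite J \<Longrightarrow> degree (\<Prod>j\<in>J. lin (a j) (b j)) \<le> card J"
proof (induction J rule: finite_induct)
  case (insert x F)
  have "degree (lin (a x) (b x) * (\<Prod>j\<in>F. lin (a j) (b j))) \<le> 1 + card F"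
    by (intro order.trans[OF degree_mult_le] add_mono insert.IH degree_lin_le)
  then show ?case using insert by simp
qed simp

lemma form_prod_lin:
  "finite J \<Longrightarrow> form (card J) (\<Prod>j\<in>J. lin (a j) (b j)) x y = (\<Prod>j\<in>J. b j * x - a j * y)"
proof (induction J rule: finite_induct)
  case empty
  then show ?case by (simp add: form_def)
next
  case (insert k F)
  have "form (1 + card F) (lin (a k) (b k) * (\<Prod>j\<in>F. lin (a j) (b j))) x y
    = form 1 (lin (a k) (b k)) x y * form (card F) (\<Prod>j\<in>F. lin (a j) (b j)) x y"
    by (intro form_mult degree_lin_le degree_prod_lin_le insert.hyps)
  then show ?case using insert by (simp add: form_lin)
qed

text \<open>A zero with \<open>a = 0\<close> means that the top coefficient vanishes:
  \<open>lin a b\<close> is then a constant and the division only lowers the nominal degree.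
  Otherwise \<open>b / a\<close> is an ordinary root of \<open>p\<close>.\<close>

lemma form_zero_factor:
  assumes "degree p \<le> Suc r" "(a, b) \<noteq> (0, 0)" "form (Suc r) p a b = 0"
  obtains q where "p = lin a b * q" "degree q \<le> r"
proof (cases "a = 0")
  case True
  with assms have b: "b \<noteq> 0" and "coeff p (Suc r) = 0" by (auto simp: form_0)
  then have "degree p \<le> r" using assms(1)
    by (metis le_SucE leading_coeff_0_iff degree_0 le0)
  then show ?thesis using b True
    by (intro that[of "smult (1 / b) p"]) (auto simp: lin_def)
next
  case False
  with assms have "poly p (b / a) = 0" by (auto simp: form_affine)
  then obtain q where q: "p = [:- (b / a), 1:] * q" by (auto simp: poly_eq_0_iff_dvd)
  have e: "p = lin a b * smult (- 1 / a) q"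
  proof -
    have "lin a b = smult (- a) [:- (b / a), 1:]" using False by (simp add: lin_def)
    then have "lin a b * smult (- 1 / a) q = smult (- a * (- 1 / a)) ([:- (b / a), 1:] * q)"
      by (simp only: mult_smult_left mult_smult_right smult_smult mult.commute)
    then show ?thesis using False q by simp
  qed
  have "degree q \<le> r"
  proof (cases "q = 0")
    case False
    then have "degree p = Suc (degree q)" using q by (subst q, subst degree_mult_eq) auto
    then show ?thesis using assms by simp
  qed simp
  then show ?thesis using e by (intro that[OF e]) simp
qed

lemma gen_pos_Suc: "gen_pos (Suc r) a b \<Longrightarrow> gen_pos r a b"
  by (auto simp: gen_pos_def)

text \<open>The zeros are divided out one at a time. The factor belonging to the last point does not
  vanish at the others, so these remain zeros of the quotient.\<close>

lemma form_zeros_le: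
  assumes "degree p \<le> r" "p \<noteq> 0" "gen_pos k a b" "\<And>j. j < k \<Longrightarrow> form r p (a j) (b j) = 0"
  shows "k \<le> r"
  using assms
proof (induction k arbitrary: p r)
  case (Suc k)
  have nz: "(a k, b k) \<noteq> (0, 0)" using Suc.prems by (auto simp: gen_pos_def)
  have "r \<noteq> 0"
  proof
    assume "r = 0"
    with Suc.prems(1) obtain c where "p = [:c:]" by (auto elim: degree_eq_zeroE)
    with Suc.prems(2) Suc.prems(4)[of k] \<open>r = 0\<close> show False by (simp add: form_def)
  qed
  then obtain r' where r: "r = Suc r'" by (cases r) auto
  obtain q where q: "p = lin (a k) (b k) * q" "degree q \<le> r'"
    using form_zero_factor[of p r' "a k" "b k"] Suc.prems nz r by auto
  have "k \<le> r'"
  proof (rule Suc.IH[OF q(2)])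
    show "q \<noteq> 0" using q Suc.prems by auto
    show "gen_pos k a b" using Suc.prems by (rule_tac gen_pos_Suc)
    fix j assume "j < k"
    have "form (1 + r') p (a j) (b j) = form 1 (lin (a k) (b k)) (a j) (b j) * form r' q (a j) (b j)"
      unfolding q(1) by (intro form_mult degree_lin_le q(2))
    moreover have "form 1 (lin (a k) (b k)) (a j) (b j) \<noteq> 0"
      using Suc.prems(3) \<open>j < k\<close> by (auto simp: form_lin gen_pos_def mult.commute)
    ultimately show "form r' q (a j) (b j) = 0" using Suc.prems(4)[of j] \<open>j < k\<close> r by simp
  qed
  then show ?case using r by simp
qed simp

text \<open>A form of positive nominal degree always has a zero: (0, 1) if the degree of the
  polynomial drops, and an affine root from the fundamental theorem of algebra otherwise.\<close>

lemma form_factorization: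
  assumes "degree p \<le> r" "p \<noteq> 0"
  obtains c a b where "c \<noteq> 0" "\<And>j. j < r \<Longrightarrow> (a j, b j) \<noteq> (0, 0)"
    "p = smult c (\<Prod>j<r. lin (a j) (b j))"
  using assms
proof (induction r arbitrary: p thesis)
  case 0
  then obtain c where "p = [:c:]" by (auto elim: degree_eq_zeroE)
  then show ?case using 0 by (intro "0.prems"(1)[of c]) auto
next
  case (Suc r)
  have "\<exists>a b. (a, b) \<noteq> (0, 0) \<and> form (Suc r) p a b = 0"
  proof (cases "degree p \<le> r")
    case True
    then show ?thesis by (intro exI[of _ 0] exI[of _ 1]) (simp add: form_0 coeff_eq_0)
  next
    case False
    then have "degree p > 0" by simp
    then have "\<not> constant (poly p)" by (simp add: constant_degree)
    then obtain z where "poly p z = 0" using fundamental_theorem_of_algebra by blast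
    then show ?thesis using Suc.prems by (intro exI[of _ 1] exI[of _ z]) (simp add: form_1)
  qed
  then obtain x y where xy: "(x, y) \<noteq> (0, 0)" "form (Suc r) p x y = 0" by blast
  obtain q where q: "p = lin x y * q" "degree q \<le> r"
    using form_zero_factor[OF Suc.prems(2) xy] .
  have "q \<noteq> 0" using q Suc.prems by auto
  then obtain c a b where c: "c \<noteq> 0" "\<And>j. j < r \<Longrightarrow> (a j, b j) \<noteq> (0, 0)"
    "q = smult c (\<Prod>j<r. lin (a j) (b j))" using Suc.IH[OF _ q(2)] by blast
  have "(\<Prod>j<r. lin ((a(r := x)) j) ((b(r := y)) j)) = (\<Prod>j<r. lin (a j) (b j))"
    by (intro prod.cong) auto
  then show ?case using c xy q
    by (intro Suc.prems(1)[of c "a(r := x)" "b(r := y)"]) (auto simp: less_Suc_eq mult.commute)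
qed

lemma not_gen_pos_square_factor:
  assumes "\<And>j. j < r \<Longrightarrow> (a j, b j) \<noteq> (0, 0)" "\<not> gen_pos r a b"
  obtains x y q where "2 \<le> r" "(x, y) \<noteq> (0, 0)" "degree q \<le> r - 2"
    "(\<Prod>j<r. lin (a j) (b j)) = lin x y * lin x y * q"
proof -
  obtain j k where jk: "j < r" "k < r" "j \<noteq> k" "a j * b k = a k * b j"
    using assms by (auto simp: gen_pos_def)
  have nz: "(a j, b j) \<noteq> (0, 0)" "(a k, b k) \<noteq> (0, 0)" using assms(1) jk by auto
  have "\<exists>l. a k = l * a j \<and> b k = l * b j"
  proof (cases "a j = 0")
    case True
    then have "b j \<noteq> 0" "a k = 0" using nz jk by auto
    then show ?thesis using True by (intro exI[of _ "b k / b j"]) auto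
  next
    case False
    then show ?thesis using jk by (intro exI[of _ "a k / a j"]) (auto simp: field_simps)
  qed
  then obtain l where l: "a k = l * a j" "b k = l * b j" by blast
  define J where "J = {..<r} - {j, k}"
  have cJ: "finite J" "card J = r - 2" using jk by (auto simp: J_def card_Diff_subset)
  have "(\<Prod>i<r. lin (a i) (b i)) = (\<Prod>i\<in>insert j (insert k J). lin (a i) (b i))"
    using jk by (intro prod.cong) (auto simp: J_def)
  also have "\<dots> = lin (a j) (b j) * (lin (a k) (b k) * (\<Prod>i\<in>J. lin (a i) (b i)))"
    using jk cJ by (simp add: J_def)
  also have "lin (a k) (b k) = smult l (lin (a j) (b j))" using l by (simp add: lin_def)
  finally show ?thesis using jk nz cJ degree_prod_lin_le[OF cJ(1), of a b]
    by (intro that[of "a j" "b j" "smult l (\<Prod>i\<in>J. lin (a i) (b i))"]) (auto simp: mult.assoc)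
qed

section \<open>Combinations of points and their limits\<close>

text \<open>For nonzero \<open>a\<close> the recursion makes \<open>h\<close> geometric with ratio
  \<open>b / a\<close>. For \<open>a = 0\<close> it kills every entry except the last one, which is
  the sequence of the point (0, b) up to a factor.\<close>

lemma lin_kernel:
  assumes "(a, b) \<noteq> (0, 0)" "\<And>t. t < d \<Longrightarrow> act (lin a b) h t = 0"
  obtains c where "\<And>t. t \<le> d \<Longrightarrow> h t = c * vm d a b t"
proof (cases "a = 0")
  case False
  have "h t = h 0 * (b / a) ^ t" if "t \<le> d" for t
    using that
  proof (induction t)
    case (Suc t)
    then have "a * h (Suc t) = b * h t" using assms(2)[of t] by (simp add: act_lin)
    then have "h (Suc t) = b / a * h t" using False by (simp add: field_simps)
    then show ?case using Suc by simp
  qed simp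
  moreover have "(b / a) ^ t = vm d a b t / a ^ d" if "t \<le> d" for t
    using that False by (simp add: vm_def power_diff field_simps)
  ultimately have "h t = h 0 / a ^ d * vm d a b t" if "t \<le> d" for t
    using that by (metis times_divide_eq_left times_divide_eq_right)
  then show ?thesis by (rule that)
next
  case True
  with assms have b: "b \<noteq> 0" by auto
  have "h t = h d / b ^ d * vm d a b t" if "t \<le> d" for t
  proof (cases "t = d")
    case False
    then have "t < d" using that by simp
    then have "h t = 0" using assms(2)[of t] True b by (simp add: act_lin)
    then show ?thesis using True \<open>t < d\<close> by (simp add: vm_def)
  qed (use b in \<open>simp add: vm_def\<close>)
  then show ?thesis by (rule that)
qed

text \<open>Solves one linear recursion. Dividing each coefficient by \<open>l j\<close>, the value
  of the new linear form at the old point \<open>j\<close>, gives a particular solution; general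
  position makes \<open>l j\<close> nonzero. The homogeneous solution contributes the new
  point.\<close>

lemma vandermonde_extend:
  assumes gp: "gen_pos (Suc r) a b"
    and lin: "\<And>t. t \<le> d \<Longrightarrow> act (lin (a r) (b r)) h t = (\<Sum>j<r. c j * vm d (a j) (b j) t)"
  shows "\<exists>c'. \<forall>t\<le>Suc d. h t = (\<Sum>j<Suc r. c' j * vm (Suc d) (a j) (b j) t)"
proof -
  define l where "l j = b r * a j - a r * b j" for j
  have l: "l j \<noteq> 0" if "j < r" for j
    using gp that unfolding gen_pos_def l_def by (auto simp: mult.commute)
  define g where "g t = h t + (\<Sum>j<r. - (c j / l j) * vm (Suc d) (a j) (b j) t)" for t
  have "act (lin (a r) (b r)) g t = 0" if "t < Suc d" for t
  proof -
    have "act (lin (a r) (b r)) g t = act (lin (a r) (b r)) h t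
      + act (lin (a r) (b r)) (\<lambda>t. \<Sum>j<r. - (c j / l j) * vm (Suc d) (a j) (b j) t) t"
      by (simp add: act_lin g_def algebra_simps)
    also have "act (lin (a r) (b r)) (\<lambda>t. \<Sum>j<r. - (c j / l j) * vm (Suc d) (a j) (b j) t) t
       = (\<Sum>j<r. - (c j / l j) * (l j * vm d (a j) (b j) t))"
    proof (subst act_sum, rule sum.cong[OF refl])
      fix j
      have "act (lin (a r) (b r)) (vm (Suc d) (a j) (b j)) t = l j * vm d (a j) (b j) t"
        using that degree_lin_le[of "a r" "b r"]
        by (subst act_vm[where r = 1]) (auto simp: form_lin l_def)
      then show "- (c j / l j) * act (lin (a r) (b r)) (vm (Suc d) (a j) (b j)) t
        = - (c j / l j) * (l j * vm d (a j) (b j) t)" by simp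
    qed
    also have "\<dots> = (\<Sum>j<r. - (c j * vm d (a j) (b j) t))"
      using l by (intro sum.cong) auto
    finally show ?thesis using lin[of t] that by (simp add: sum_negf)
  qed
  moreover have "(a r, b r) \<noteq> (0, 0)" using gp by (auto simp: gen_pos_def)
  ultimately obtain e where e: "\<And>t. t \<le> Suc d \<Longrightarrow> g t = e * vm (Suc d) (a r) (b r) t"
    using lin_kernel[of "a r" "b r" "Suc d" g] by blast
  show ?thesis
  proof (intro exI[of _ "\<lambda>j. if j = r then e else c j / l j"] allI impI)
    fix t assume "t \<le> Suc d"
    have "(\<Sum>j<r. (if j = r then e else c j / l j) * vm (Suc d) (a j) (b j) t)
       = - (\<Sum>j<r. - (c j / l j) * vm (Suc d) (a j) (b j) t)"
      unfolding sum_negf[symmetric] by (intro sum.cong) auto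
    then show "h t = (\<Sum>j<Suc r. (if j = r then e else c j / l j) * vm (Suc d) (a j) (b j) t)"
      using e[OF \<open>t \<le> Suc d\<close>] by (simp add: g_def algebra_simps)
  qed
qed

lemma annih_mult_iff:
  assumes "degree p \<le> r" "degree q \<le> s"
  shows "annih d (r + s) (p * q) h \<longleftrightarrow> (\<forall>i. i + (r + s) \<le> d \<longrightarrow> act p (act q h) i = 0)"
  using order.trans[OF degree_mult_le add_mono[OF assms]] by (simp add: annih_def act_mult)

lemma annih_lin_mult:
  assumes "degree p \<le> r"
  shows "annih (Suc d) (Suc r) (p * lin a b) h \<longleftrightarrow> annih d r p (act (lin a b) h)"
  using annih_mult_iff[OF assms degree_lin_le[of a b], of "Suc d" h] assms
  by (simp add: annih_def)

lemma annih_0_0: "annih d 0 1 h \<longleftrightarrow> (\<forall>t\<le>d. h t = 0)"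
  by (simp add: annih_def)

lemma sylvester_decomposition:
  assumes "gen_pos r a b" "annih d r (\<Prod>j<r. lin (a j) (b j)) h"
  obtains c where "\<And>t. t \<le> d \<Longrightarrow> h t = (\<Sum>j<r. c j * vm d (a j) (b j) t)"
  using assms
proof (induction r arbitrary: d h thesis)
  case 0
  then show ?case by (auto simp: annih_0_0)
next
  case (Suc r)
  show ?case
  proof (cases d)
    case 0
    \<comment> \<open>For \<open>d = 0\<close> no recursion remains. Every point has the constant
      sequence 1, so the last point alone carries \<open>h 0\<close>.\<close>
    then show ?thesis using Suc.prems(1)[of "\<lambda>j. if j = r then h 0 else 0"]
      by (simp add: vm_def)
  next
    case (Suc d')
    define p where "p = (\<Prod>j<r. lin (a j) (b j))"
    have "annih d' r p (act (lin (a r) (b r)) h)"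
      using Suc.prems(3) degree_prod_lin_le[of "{..<r}" a b] unfolding Suc
      by (simp add: p_def annih_lin_mult)
    then obtain c where "\<And>t. t \<le> d' \<Longrightarrow> act (lin (a r) (b r)) h t = (\<Sum>j<r. c j * vm d' (a j) (b j) t)"
      using Suc.IH gen_pos_Suc[OF Suc.prems(2)] unfolding p_def by blast
    then have "\<exists>c'. \<forall>t\<le>Suc d'. h t = (\<Sum>j<Suc r. c' j * vm (Suc d') (a j) (b j) t)"
      by (rule vandermonde_extend[OF Suc.prems(2)])
    then show ?thesis using Suc.prems(1) unfolding Suc by blast
  qed
qed

section \<open>Sums of point sequences without coefficients\<close>

definition vrep :: "nat \<Rightarrow> nat \<Rightarrow> (nat \<Rightarrow> complex) \<Rightarrow> bool" where
  "vrep d q h \<longleftrightarrow> (\<exists>a b. \<forall>t\<le>d. h t = (\<Sum>j<q. vm d (a j) (b j) t))"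

lemma complex_root_exists:
  assumes "d > 0"
  shows "\<exists>z :: complex. z ^ d = c"
proof -
  have "degree (monom 1 d - [:c:]) = d"
    using assms by (subst diff_conv_add_uminus, subst degree_add_eq_left) (auto simp: degree_monom_eq)
  then have "\<not> constant (poly (monom 1 d - [:c:]))" using assms by (simp add: constant_degree)
  then obtain z where "poly (monom 1 d - [:c:]) z = 0" using fundamental_theorem_of_algebra by blast
  then show ?thesis by (auto simp: poly_monom)
qed

text \<open>A coefficient is absorbed into its point by scaling the point with a \<open>d\<close>-th
  root, which exists over the complex numbers because \<open>d > 0\<close>.\<close>

lemma vrepI:
  assumes "d > 0" "finite J" "\<And>t. t \<le> d \<Longrightarrow> h t = (\<Sum>j\<in>J. c j * vm d (a j) (b j) t)"
  shows "vrep d (card J) h"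
proof -
  obtain f where f: "bij_betw f {..<card J} J"
    using ex_bij_betw_nat_finite[OF assms(2)] by (auto simp: atLeast0LessThan)
  obtain g where g: "\<And>j. g j ^ d = c j" 
    using choice[of "\<lambda>j z. z ^ d = c j"] complex_root_exists[OF assms(1)] by blast
  have "h t = (\<Sum>j<card J. vm d (g (f j) * a (f j)) (g (f j) * b (f j)) t)" if "t \<le> d" for t
  proof -
    have "vm d (g j * a j) (g j * b j) t = c j * vm d (a j) (b j) t" for j
      using that by (simp add: vm_def power_mult_distrib g[symmetric] flip: power_add)
    then show ?thesis using assms(3)[OF that]
      sum.reindex_bij_betw[OF f, of "\<lambda>j. vm d (g j * a j) (g j * b j) t"] by simp
  qed
  then show ?thesis unfolding vrep_def
    by (intro exI[of _ "\<lambda>j. g (f j) * a (f j)"] exI[of _ "\<lambda>j. g (f j) * b (f j)"]) simp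
qed

lemma vrep_mono:
  assumes "d > 0" "vrep d q h" "q \<le> q'"
  shows "vrep d q' h"
proof -
  obtain a b where ab: "\<And>t. t \<le> d \<Longrightarrow> h t = (\<Sum>j<q. vm d (a j) (b j) t)"
    using assms(2) unfolding vrep_def by blast
  have "(\<Sum>j<q'. vm d (if j < q then a j else 0) (if j < q then b j else 0) t)
      = (\<Sum>j<q. vm d (a j) (b j) t)" if "t \<le> d" for t
    using that assms
    by (intro sum.mono_neutral_cong_right) (auto simp: vm_def power_0_left)
  with ab show ?thesis unfolding vrep_def
    by (intro exI[of _ "\<lambda>j. if j < q then a j else 0"] exI[of _ "\<lambda>j. if j < q then b j else 0"]) simp
qed

lemma vrep_of_annih:
  assumes "d > 0" "gen_pos r a b" "annih d r (\<Prod>j<r. lin (a j) (b j)) h"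
  shows "vrep d r h"
proof -
  obtain c where "\<And>t. t \<le> d \<Longrightarrow> h t = (\<Sum>j<r. c j * vm d (a j) (b j) t)"
    using sylvester_decomposition[OF assms(2,3)] by blast
  then show ?thesis using vrepI[of d "{..<r}" h c a b] assms(1) by simp
qed

text \<open>In nominal degree \<open>d + 1\<close> annihilation imposes no equations, so any
  \<open>d + 1\<close> distinct points represent \<open>h\<close>. This ensures that the minima
  defining Vandermonde ranks are attained.\<close>

lemma vrep_Suc:
  assumes "d > 0"
  shows "vrep d (Suc d) h"
proof (rule vrep_of_annih[OF assms])
  show "gen_pos (Suc d) (\<lambda>_. 1) of_nat" by (auto simp: gen_pos_def)
  show "annih d (Suc d) (\<Prod>j<Suc d. lin 1 (of_nat j)) h"
    using degree_prod_lin_le[of "{..<Suc d}" "\<lambda>_. 1" of_nat] by (simp add: annih_def)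
qed

text \<open>Forward substitution solves the perturbed recursion, with an error tending to zero.\<close>

lemma recursion_perturbation:
  fixes bt :: "nat \<Rightarrow> complex"
  assumes "a \<noteq> 0" "bt \<longlonglongrightarrow> b" "\<And>i. (\<lambda>t. k t i) \<longlonglongrightarrow> 0"
  obtains e where "\<And>t i. bt t * e t i - a * e t (Suc i) = k t i" "\<And>i. (\<lambda>t. e t i) \<longlonglongrightarrow> 0"
proof -
  define e where "e t = rec_nat (0 :: complex) (\<lambda>i x. (bt t * x - k t i) / a)" for t
  have e: "e t 0 = 0" "e t (Suc i) = (bt t * e t i - k t i) / a" for t i by (simp_all add: e_def)
  have "(\<lambda>t. e t i) \<longlonglongrightarrow> 0" for i
  proof (induction i)
    case (Suc i)
    have "(\<lambda>t. (bt t * e t i - k t i) / a) \<longlonglongrightarrow> (b * 0 - 0) / a"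
      by (intro tendsto_intros assms Suc)
    then show ?case by (simp add: e)
  qed (simp add: e)
  moreover have "bt t * e t i - a * e t (Suc i) = k t i" for t i
    using assms(1) by (simp add: e)
  ultimately show ?thesis by (intro that[of e])
qed

section \<open>Perturbed points and limits of representations\<close>

lemma avoiding_null_sequence:
  assumes "\<And>t :: nat. finite (B t)"
  shows "\<exists>\<epsilon> :: nat \<Rightarrow> complex. \<epsilon> \<longlonglongrightarrow> 0 \<and> (\<forall>t. \<epsilon> t \<notin> B t)"
proof -
  have "\<exists>x :: real. 0 < x \<and> x < inverse (real (Suc t)) \<and> complex_of_real x \<notin> B t" for t
  proof -
    have "finite (complex_of_real -` B t)"
      by (rule finite_vimageI[OF assms]) (simp add: inj_def)
    moreover have "infinite {0<..<inverse (real (Suc t))}" by (intro infinite_Ioo) simp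
    ultimately have "{0<..<inverse (real (Suc t))} - complex_of_real -` B t \<noteq> {}"
      by (metis Diff_eq_empty_iff finite_subset)
    then show ?thesis by auto
  qed
  then obtain x where x: "\<And>t. 0 < x t \<and> x t < inverse (real (Suc t)) \<and> complex_of_real (x t) \<notin> B t"
    by metis
  have "x \<longlonglongrightarrow> 0"
    by (rule tendsto_sandwich[OF _ _ tendsto_const LIMSEQ_inverse_real_of_nat])
      (use x in \<open>auto intro!: always_eventually less_imp_le\<close>)
  then have "(\<lambda>t. complex_of_real (x t)) \<longlonglongrightarrow> 0" using tendsto_of_real[of x 0] by simp
  then show ?thesis using x by (intro exI[of _ "\<lambda>t. complex_of_real (x t)"]) auto
qed

text \<open>A nonzero coordinate of the point is kept and the other is moved by a null sequence that
  avoids the finitely many values producing an old point. The solution is sought as \<open>h\<close>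
  plus an error; the error solves a recursion with the kept coordinate as pivot and a right-hand
  side tending to 0.\<close>

lemma lin_perturbation:
  fixes a b :: complex and r d :: nat and a' b' k :: "nat \<Rightarrow> nat \<Rightarrow> complex"
  assumes nz: "(a, b) \<noteq> (0, 0)"
    and nzp: "\<And>t j. j < r \<Longrightarrow> (a' t j, b' t j) \<noteq> (0, 0)"
    and k: "\<And>i. i < d \<Longrightarrow> (\<lambda>t. k t i) \<longlonglongrightarrow> act (lin a b) h i"
  shows "\<exists>x y g. (\<forall>t. (x t, y t) \<noteq> (0, 0)) \<and> (\<forall>t j. j < r \<longrightarrow> x t * b' t j \<noteq> a' t j * y t) \<and>
    (\<forall>t i. i < d \<longrightarrow> act (lin (x t) (y t)) (g t) i = k t i) \<and>
    (\<forall>i\<le>d. (\<lambda>t. g t i) \<longlonglongrightarrow> h i)"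
proof (cases "a = 0")
  case False
  have "\<exists>\<epsilon>. \<epsilon> \<longlonglongrightarrow> 0 \<and> (\<forall>t. \<epsilon> t \<notin> (\<lambda>j. a * b' t j / a' t j - b) ` {..<r})"
    by (rule avoiding_null_sequence) simp
  then obtain \<epsilon> where e: "\<epsilon> \<longlonglongrightarrow> 0" "\<And>t. \<epsilon> t \<notin> (\<lambda>j. a * b' t j / a' t j - b) ` {..<r}" by blast
  define y where "y = (\<lambda>t. b + \<epsilon> t)"
  have y: "y \<longlonglongrightarrow> b" using tendsto_add[OF tendsto_const[of b] e(1)] by (simp add: y_def)
  \<comment> \<open>The defect of \<open>h\<close> in the perturbed recursion. It is cut off at
    \<open>d\<close> because \<open>k\<close> is only known to converge below
    \<open>d\<close>.\<close>
  define k' where "k' t i = (if i < d then k t i - act (lin a (y t)) h i else 0)" for t i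
  have "(\<lambda>t. k' t i) \<longlonglongrightarrow> 0" for i
  proof (cases "i < d")
    case True
    have "(\<lambda>t. k t i - (y t * h i - a * h (Suc i))) \<longlonglongrightarrow> act (lin a b) h i - (b * h i - a * h (Suc i))"
      by (intro tendsto_intros k y True)
    then show ?thesis using True by (simp add: k'_def act_lin)
  qed (simp add: k'_def)
  then obtain f where f: "\<And>t i. y t * f t i - a * f t (Suc i) = k' t i" "\<And>i. (\<lambda>t. f t i) \<longlonglongrightarrow> 0"
    using recursion_perturbation[OF False y, of k'] by blast
  show ?thesis
  proof (rule exI[of _ "\<lambda>_. a"], rule exI[of _ y], rule exI[of _ "\<lambda>t i. h i + f t i"], intro conjI allI impI)
    fix t j assume "j < r"
    then have "a' t j \<noteq> 0 \<Longrightarrow> \<epsilon> t \<noteq> a * b' t j / a' t j - b" using e(2)[of t] by auto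
    then show "a * b' t j \<noteq> a' t j * y t"
      using nzp[OF \<open>j < r\<close>, of t] False by (cases "a' t j = 0") (auto simp: y_def field_simps)
  next
    fix t i assume "i < d"
    have "act (lin a (y t)) (\<lambda>i. h i + f t i) i = act (lin a (y t)) h i + (y t * f t i - a * f t (Suc i))"
      by (simp add: act_lin algebra_simps)
    then show "act (lin a (y t)) (\<lambda>i. h i + f t i) i = k t i" using \<open>i < d\<close> by (simp add: f k'_def)
  next
    fix i
    show "(\<lambda>t. h i + f t i) \<longlonglongrightarrow> h i" using tendsto_add[OF tendsto_const f(2)] by simp
  qed (use False in simp)
next
  case True
  with nz have b: "b \<noteq> 0" by simp
  have "\<exists>x. x \<longlonglongrightarrow> 0 \<and> (\<forall>t. x t \<notin> (\<lambda>j. a' t j * b / b' t j) ` {..<r})"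
    by (rule avoiding_null_sequence) simp
  then obtain x where x: "x \<longlonglongrightarrow> 0" "\<And>t. x t \<notin> (\<lambda>j. a' t j * b / b' t j) ` {..<r}" by blast
  \<comment> \<open>Now \<open>b\<close> is the pivot, so the recursion has to run downwards from
    \<open>d\<close>. The substitution of \<open>d - i\<close> for \<open>i\<close> brings it into
    the form already solved.\<close>
  define k' where "k' t i = (if i < d then act (lin (x t) b) h (d - Suc i) - k t (d - Suc i) else 0)" for t i
  have "(\<lambda>t. k' t i) \<longlonglongrightarrow> 0" for i
  proof (cases "i < d")
    case d: True
    have "(\<lambda>t. (b * h (d - Suc i) - x t * h (Suc (d - Suc i))) - k t (d - Suc i))
      \<longlonglongrightarrow> (b * h (d - Suc i) - 0 * h (Suc (d - Suc i))) - act (lin a b) h (d - Suc i)"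
      using d by (intro tendsto_intros k x) auto
    then show ?thesis using d True by (simp add: k'_def act_lin)
  qed (simp add: k'_def)
  then obtain f where f: "\<And>t i. x t * f t i - b * f t (Suc i) = k' t i" "\<And>i. (\<lambda>t. f t i) \<longlonglongrightarrow> 0"
    using recursion_perturbation[OF b x(1), of k'] by blast
  show ?thesis
  proof (rule exI[of _ x], rule exI[of _ "\<lambda>_. b"], rule exI[of _ "\<lambda>t i. h i + f t (d - i)"], intro conjI allI impI)
    fix t j assume "j < r"
    then have "b' t j \<noteq> 0 \<Longrightarrow> x t \<noteq> a' t j * b / b' t j" using x(2)[of t] by auto
    then show "x t * b' t j \<noteq> a' t j * b"
      using nzp[OF \<open>j < r\<close>, of t] b by (cases "b' t j = 0") (auto simp: field_simps)
  next
    fix t i assume "i < d"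
    then have s: "d - i = Suc (d - Suc i)" "d - Suc (d - Suc i) = i" by auto
    have "act (lin (x t) b) (\<lambda>i. h i + f t (d - i)) i
      = act (lin (x t) b) h i - (x t * f t (d - Suc i) - b * f t (Suc (d - Suc i)))"
      by (simp add: act_lin s(1)[symmetric] algebra_simps)
    then show "act (lin (x t) b) (\<lambda>i. h i + f t (d - i)) i = k t i"
      using \<open>i < d\<close> s(2) by (simp add: f k'_def)
  next
    fix i
    show "(\<lambda>t. h i + f t (d - i)) \<longlonglongrightarrow> h i" using tendsto_add[OF tendsto_const f(2)] by simp
  qed (use b in simp)
qed

text \<open>The induction of \<open>sylvester_decomposition\<close>, with repeated factors allowed:
  the reduced sequence is approximated by distinct points, and at each \<open>t\<close> the new
  point is perturbed away from them.\<close>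

lemma sylvester_approximation:
  assumes "\<And>j. j < r \<Longrightarrow> (a j, b j) \<noteq> (0, 0)" "annih d r (\<Prod>j<r. lin (a j) (b j)) h"
  shows "\<exists>a' b' c g. (\<forall>t :: nat. gen_pos r (a' t) (b' t)) \<and>
    (\<forall>t. \<forall>i\<le>d. g t i = (\<Sum>j<r. c t j * vm d (a' t j) (b' t j) i)) \<and>
    (\<forall>i\<le>d. (\<lambda>t. g t i) \<longlonglongrightarrow> h i)"
  using assms
proof (induction r arbitrary: d h)
  case 0
  then show ?case
    by (intro exI[of _ "\<lambda>_ _. 0"]) (auto simp: gen_pos_def annih_0_0)
next
  case (Suc r)
  show ?case
  proof (cases d)
    case 0
    show ?thesis
      by (rule exI[of _ "\<lambda>_ _. 1"], rule exI[of _ "\<lambda>_. of_nat"],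
          rule exI[of _ "\<lambda>_ j. if j = r then h 0 else 0"], rule exI[of _ "\<lambda>_. h"])
        (auto simp: gen_pos_def vm_def 0)
  next
    case (Suc d')
    define p where "p = (\<Prod>j<r. lin (a j) (b j))"
    have "annih d' r p (act (lin (a r) (b r)) h)"
      using Suc.prems(2) degree_prod_lin_le[of "{..<r}" a b] unfolding Suc
      by (simp add: p_def annih_lin_mult)
    moreover have "\<And>j. j < r \<Longrightarrow> (a j, b j) \<noteq> (0, 0)" using Suc.prems(1) by simp
    ultimately obtain a' b' c k where k: "\<forall>t. gen_pos r (a' t) (b' t)"
      "\<forall>t. \<forall>i\<le>d'. k t i = (\<Sum>j<r. c t j * vm d' (a' t j) (b' t j) i)"
      "\<forall>i\<le>d'. (\<lambda>t. k t i) \<longlonglongrightarrow> act (lin (a r) (b r)) h i"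
      using Suc.IH[of d' "act (lin (a r) (b r)) h"] unfolding p_def by blast
    have 1: "(a' t j, b' t j) \<noteq> (0, 0)" if "j < r" for t j
      using k(1) that by (simp add: gen_pos_def)
    have 2: "(\<lambda>t. k t i) \<longlonglongrightarrow> act (lin (a r) (b r)) h i" if "i < d" for i
      using k(3) that Suc by simp
    have "\<exists>x y g. (\<forall>t. (x t, y t) \<noteq> (0, 0)) \<and> (\<forall>t j. j < r \<longrightarrow> x t * b' t j \<noteq> a' t j * y t) \<and>
      (\<forall>t i. i < d \<longrightarrow> act (lin (x t) (y t)) (g t) i = k t i) \<and>
      (\<forall>i\<le>d. (\<lambda>t. g t i) \<longlonglongrightarrow> h i)"
      by (rule lin_perturbation[OF Suc.prems(1)[OF lessI]]) (use 1 2 in blast)+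
    then obtain x y g where g: "\<And>t. (x t, y t) \<noteq> (0, 0)"
      "\<And>t j. j < r \<Longrightarrow> x t * b' t j \<noteq> a' t j * y t"
      "\<And>t i. i < d \<Longrightarrow> act (lin (x t) (y t)) (g t) i = k t i"
      "\<And>i. i \<le> d \<Longrightarrow> (\<lambda>t. g t i) \<longlonglongrightarrow> h i" by blast
    define a'' b'' where "a'' t = (a' t)(r := x t)" and "b'' t = (b' t)(r := y t)" for t
    have gp: "gen_pos (Suc r) (a'' t) (b'' t)" for t
    proof -
      have "a' t j * y t \<noteq> x t * b' t j" if "j < r" for j using g(2)[OF that, of t] by metis
      then show ?thesis
        using k(1) g(1)[of t] g(2)[of _ t] unfolding gen_pos_def a''_def b''_def
        by (auto simp: less_Suc_eq)
    qed
    have "\<exists>c'. \<forall>i\<le>d. g t i = (\<Sum>j<Suc r. c' j * vm d (a'' t j) (b'' t j) i)" for t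
    proof -
      have "act (lin (a'' t r) (b'' t r)) (g t) i = (\<Sum>j<r. c t j * vm d' (a'' t j) (b'' t j) i)"
        if "i \<le> d'" for i
        using that g(3)[of i t] k(2) Suc by (simp add: a''_def b''_def)
      then show ?thesis unfolding Suc by (rule vandermonde_extend[OF gp])
    qed
    then obtain c' where "\<forall>t. \<forall>i\<le>d. g t i = (\<Sum>j<Suc r. c' t j * vm d (a'' t j) (b'' t j) i)"
      using choice[of "\<lambda>t c'. \<forall>i\<le>d. g t i = (\<Sum>j<Suc r. c' j * vm d (a'' t j) (b'' t j) i)"] by blast
    then show ?thesis using gp g(4) by blast
  qed
qed

lemma vrep_approximation:
  assumes "d > 0" "p \<noteq> 0" "annih d r p h"
  obtains g where "\<And>t :: nat. vrep d r (g t)" "\<And>i. i \<le> d \<Longrightarrow> (\<lambda>t. g t i) \<longlonglongrightarrow> h i"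
proof -
  obtain c a b where f: "c \<noteq> 0" "\<And>j. j < r \<Longrightarrow> (a j, b j) \<noteq> (0, 0)"
    "p = smult c (\<Prod>j<r. lin (a j) (b j))"
    using form_factorization[of p r] assms by (auto simp: annih_def)
  have "annih d r (\<Prod>j<r. lin (a j) (b j)) h"
    using assms(3) f by (auto simp: annih_def act_smult)
  from sylvester_approximation[OF f(2) this]
  obtain a' b' c' g where g: "\<And>t i. i \<le> d \<Longrightarrow> g t i = (\<Sum>j<r. c' t j * vm d (a' t j) (b' t j) i)"
    "\<And>i. i \<le> d \<Longrightarrow> (\<lambda>t :: nat. g t i) \<longlonglongrightarrow> h i"
    by blast
  then show ?thesis using vrepI[OF assms(1), of "{..<r}"] by (intro that[of g]) auto
qed

section \<open>Squarefree annihilators\<close>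

text \<open>Duality in finite dimension, by induction on the number of functionals. If the last one
  is nonzero at some \<open>g0\<close> in the kernel of the others, subtracting the multiple
  \<open>c\<close> of it from \<psi> makes the difference vanish on that whole kernel, since a
  multiple of \<open>g0\<close> corrects any \<open>g\<close> there into the smaller kernel.\<close>

lemma functional_in_span:
  fixes \<phi> :: "nat \<Rightarrow> nat \<Rightarrow> complex"
  assumes "\<And>g. (\<forall>i<k. (\<Sum>j<N. \<phi> i j * g j) = 0) \<Longrightarrow> (\<Sum>j<N. \<psi> j * g j) = 0"
  shows "\<exists>w. \<forall>j<N. \<psi> j = (\<Sum>i<k. w i * \<phi> i j)"
  using assms
proof (induction k arbitrary: \<psi>)
  case 0
  have "\<psi> j = 0" if "j < N" for j
  proof -
    have "(\<Sum>l<N. \<psi> l * (if l = j then 1 else 0)) = 0" by (rule 0) simp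
    then show ?thesis using that by (simp add: if_distrib sum.delta cong: if_cong)
  qed
  then show ?case by simp
next
  case (Suc k)
  show ?case
  proof (cases "\<exists>g. (\<forall>i<k. (\<Sum>j<N. \<phi> i j * g j) = 0) \<and> (\<Sum>j<N. \<phi> k j * g j) \<noteq> 0")
    case False
    have "\<exists>w. \<forall>j<N. \<psi> j = (\<Sum>i<k. w i * \<phi> i j)"
      by (rule Suc.IH) (use Suc.prems False in \<open>auto simp: less_Suc_eq\<close>)
    then obtain w where "\<forall>j<N. \<psi> j = (\<Sum>i<k. w i * \<phi> i j)" by blast
    then show ?thesis by (intro exI[of _ "w(k := 0)"]) auto
  next
    case True
    then obtain g0 where g0: "\<forall>i<k. (\<Sum>j<N. \<phi> i j * g0 j) = 0" "(\<Sum>j<N. \<phi> k j * g0 j) \<noteq> 0"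
      by blast
    define c where "c = (\<Sum>j<N. \<psi> j * g0 j) / (\<Sum>j<N. \<phi> k j * g0 j)"
    have "\<exists>w. \<forall>j<N. \<psi> j - c * \<phi> k j = (\<Sum>i<k. w i * \<phi> i j)"
    proof (rule Suc.IH)
      fix g assume g: "\<forall>i<k. (\<Sum>j<N. \<phi> i j * g j) = 0"
      define e where "e = (\<Sum>j<N. \<phi> k j * g j) / (\<Sum>j<N. \<phi> k j * g0 j)"
      have sum: "(\<Sum>j<N. \<theta> j * (g j - e * g0 j)) = (\<Sum>j<N. \<theta> j * g j) - e * (\<Sum>j<N. \<theta> j * g0 j)"
        for \<theta> :: "nat \<Rightarrow> complex"
        by (simp add: algebra_simps sum_subtractf sum_distrib_left)
      have "(\<Sum>j<N. \<phi> i j * (g j - e * g0 j)) = 0" if "i < Suc k" for i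
      proof (cases "i = k")
        case True
        then show ?thesis using g0(2) unfolding sum by (simp add: e_def)
      qed (use that g g0(1) in \<open>simp add: sum\<close>)
      then have "(\<Sum>j<N. \<psi> j * (g j - e * g0 j)) = 0" by (intro Suc.prems) blast
      then have "(\<Sum>j<N. \<psi> j * g j) = e * (\<Sum>j<N. \<psi> j * g0 j)" by (simp add: sum)
      also have "\<dots> = c * (\<Sum>j<N. \<phi> k j * g j)" by (simp add: e_def c_def)
      finally show "(\<Sum>j<N. (\<psi> j - c * \<phi> k j) * g j) = 0"
        by (simp add: left_diff_distrib sum_subtractf sum_distrib_left mult.assoc)
    qed
    then obtain w where w: "\<forall>j<N. \<psi> j - c * \<phi> k j = (\<Sum>i<k. w i * \<phi> i j)" by blast
    have "\<psi> j = (\<Sum>i<Suc k. (w(k := c)) i * \<phi> i j)" if "j < N" for j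
    proof -
      have "(\<Sum>i<k. (w(k := c)) i * \<phi> i j) = (\<Sum>i<k. w i * \<phi> i j)" by (intro sum.cong) auto
      then show ?thesis using w that by (simp add: algebra_simps)
    qed
    then show ?thesis by blast
  qed
qed

definition poly_of :: "nat \<Rightarrow> (nat \<Rightarrow> complex) \<Rightarrow> complex poly" where
  "poly_of r f = (\<Sum>j\<le>r. monom (f j) j)"

lemma coeff_poly_of: "coeff (poly_of r f) j = (if j \<le> r then f j else 0)"
  by (simp add: poly_of_def coeff_sum)

lemma degree_poly_of: "degree (poly_of r f) \<le> r"
  by (rule degree_le) (simp add: coeff_poly_of)

lemma form_poly_of: "form r (poly_of r f) x y = (\<Sum>j\<le>r. f j * x ^ (r - j) * y ^ j)"
  by (simp add: form_def coeff_poly_of)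

lemma act_poly_of: "act (poly_of r f) h i = (\<Sum>j\<le>r. f j * h (i + j))"
  by (simp add: act_bound[OF degree_poly_of] coeff_poly_of)

definition no_annih :: "nat \<Rightarrow> nat \<Rightarrow> (nat \<Rightarrow> complex) \<Rightarrow> bool" where
  "no_annih d r h \<longleftrightarrow> (\<forall>p. annih d r p h \<longrightarrow> p = 0)"

text \<open>A point at which all annihilators vanish gives a linear relation between their
  coefficients; applying the linear form of that point to this relation produces an annihilator
  of degree \<open>k + 1\<close>.\<close>

lemma annih_base_point_free:
  assumes "d = q + k" "no_annih d (Suc k) h" "(a, b) \<noteq> (0, 0)"
  shows "\<exists>g. annih d q g h \<and> form q g a b \<noteq> 0"
proof (rule ccontr)
  assume contr: "\<not> ?thesis"
  \<comment> \<open>Evaluation at \<open>(a, b)\<close> has coefficients \<open>vm q a b\<close> and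
    vanishes on the kernel of the catalecticant, so it is a combination of the rows.\<close>
  have "\<exists>w. \<forall>j<Suc q. vm q a b j = (\<Sum>i<Suc k. w i * h (i + j))"
  proof (rule functional_in_span)
    fix g assume g: "\<forall>i<Suc k. (\<Sum>j<Suc q. h (i + j) * g j) = 0"
    have "annih d q (poly_of q g) h"
      using g assms(1) by (auto simp: annih_def degree_poly_of act_poly_of lessThan_Suc_atMost mult.commute)
    with contr have "form q (poly_of q g) a b = 0" by blast
    then show "(\<Sum>j<Suc q. vm q a b j * g j) = 0"
      by (simp add: form_poly_of vm_def lessThan_Suc_atMost mult_ac)
  qed
  then obtain w where w: "\<And>j. j \<le> q \<Longrightarrow> vm q a b j = (\<Sum>i<Suc k. w i * h (i + j))"
    by (auto simp: less_Suc_eq_le)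
  \<comment> \<open>Read as a form of degree \<open>k\<close>, the relation \<open>w\<close> sends
    \<open>h\<close> to the sequence of the point \<open>(a, b)\<close>, which
    \<open>lin a b\<close> kills.\<close>
  define W where "W = poly_of k w"
  have W: "act W h j = vm q a b j" if "j \<le> q" for j
    using w[OF that] by (simp add: W_def act_poly_of lessThan_Suc_atMost add.commute)
  have "annih d (Suc k) (lin a b * W) h"
    unfolding annih_def
  proof (intro conjI allI impI)
    show "degree (lin a b * W) \<le> Suc k"
      using degree_mult_le[of "lin a b" W] degree_lin_le[of a b] degree_poly_of[of k w]
      by (simp add: W_def)
    fix i assume "i + Suc k \<le> d"
    then have "Suc i \<le> q" using assms(1) by simp
    then have s: "q - i = Suc (q - Suc i)" by simp
    have "act (lin a b * W) h i = b * vm q a b i - a * vm q a b (Suc i)"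
      using \<open>Suc i \<le> q\<close> by (simp add: act_mult act_lin W)
    then show "act (lin a b * W) h i = 0" by (simp add: vm_def s)
  qed
  then have "lin a b * W = 0" using assms(2) unfolding no_annih_def by blast
  then have "W = 0" using assms(3) by auto
  then have "vm q a b j = 0" if "j \<le> q" for j using W[OF that] by simp
  from this[of 0] this[of q] assms(3) show False by (simp add: vm_def)
qed

section \<open>Generic members of spaces of annihilators\<close>

lemma annih_add: "annih d q p h \<Longrightarrow> annih d q g h \<Longrightarrow> annih d q (p + g) h"
  by (auto simp: annih_def act_add degree_add_le)

lemma annih_smult: "annih d q p h \<Longrightarrow> annih d q (smult c p) h"
  by (auto simp: annih_def act_smult intro: order.trans[OF degree_smult_le])

lemma infinite_complex_avoid:
  assumes "finite (B :: complex set)"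
  obtains t where "t \<notin> B"
  using assms infinite_UNIV_char_0[where 'a = complex] by (metis UNIV_I finite_subset subsetI)

text \<open>To treat a new point, a multiple \<open>t\<close> of an annihilator nonzero there is
  added to the one found so far. Each point forbids at most one value of \<open>t\<close>.\<close>

lemma annih_avoid_points:
  assumes "finite Z" "\<And>a b. (a, b) \<in> Z \<Longrightarrow> \<exists>g. annih d q g h \<and> form q g a b \<noteq> 0"
  shows "\<exists>g. annih d q g h \<and> (\<forall>(a, b)\<in>Z. form q g a b \<noteq> 0)"
  using assms
proof (induction Z rule: finite_induct)
  case empty
  have "annih d q 0 h" by (simp add: annih_def)
  then show ?case by blast
next
  case (insert z Z)
  obtain x y where z: "z = (x, y)" by (cases z)
  obtain g where g: "annih d q g h" "\<And>a b. (a, b) \<in> Z \<Longrightarrow> form q g a b \<noteq> 0"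
    using insert.IH insert.prems by fastforce
  obtain k where k: "annih d q k h" "form q k x y \<noteq> 0" using insert.prems[of x y] z by auto
  obtain t where t: "t \<notin> insert (- form q g x y / form q k x y) ((\<lambda>(a, b). - form q g a b / form q k a b) ` Z)"
    using infinite_complex_avoid[of "insert (- form q g x y / form q k x y) ((\<lambda>(a, b). - form q g a b / form q k a b) ` Z)"]
      insert.hyps by blast
  have "form q (g + smult t k) a b \<noteq> 0" if "(a, b) \<in> insert z Z" for a b
  proof (cases "form q k a b = 0")
    case True
    then show ?thesis using that z k g by (auto simp: form_add form_smult)
  next
    case False
    have "t \<noteq> - form q g a b / form q k a b" using t that z by force
    then show ?thesis using False by (auto simp: form_add form_smult field_simps eq_neg_iff_add_eq_0 add.commute)
  qed
  then show ?case using annih_add[OF g(1) annih_smult[OF k(1), of t]] by blast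
qed

text \<open>At a root of \<open>G\<close> the derivative of \<open>G\<close> has order one less than
  \<open>G\<close>, while \<open>F\<close> has order 0. Comparing orders in F G' = F' G gives a
  contradiction.\<close>

lemma wronskian_nonzero:
  fixes F G :: "complex poly"
  assumes "F \<noteq> 0" "degree G > 0" "\<And>z. poly F z = 0 \<Longrightarrow> poly G z \<noteq> 0"
  shows "F * pderiv G - pderiv F * G \<noteq> 0"
proof
  assume "F * pderiv G - pderiv F * G = 0"
  then have e: "F * pderiv G = pderiv F * G" by simp
  have G': "pderiv G \<noteq> 0" using assms(2) by (simp add: pderiv_eq_0_iff)
  then have G: "G \<noteq> 0" by auto
  have F': "pderiv F \<noteq> 0" using e G' assms(1) by auto
  have "\<not> constant (poly G)" using assms(2) by (simp add: constant_degree)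
  then obtain z where z: "poly G z = 0" using fundamental_theorem_of_algebra by blast
  then have "poly F z \<noteq> 0" using assms(3) by blast
  then have "order z F = 0" by (simp add: order_root)
  moreover have "order z G = Suc (order z (pderiv G))" using order_pderiv[OF G z] by blast
  moreover have "order z F + order z (pderiv G) = order z (pderiv F) + order z G"
    using arg_cong[OF e, of "order z"] assms(1) G G' F' by (simp add: order_mult)
  ultimately show False by simp
qed

text \<open>In a pencil spanned by two polynomials without common roots, a multiple root of a member is
  a root of the Wronskian and determines that member.\<close>

lemma pencil_simple_roots:
  fixes F G :: "complex poly"
  assumes "F \<noteq> 0" "degree F \<le> q" "degree G = q" "q > 0" "\<And>z. poly F z = 0 \<Longrightarrow> poly G z \<noteq> 0"
  obtains t where "degree (G + smult t F) = q"
    "\<And>z. poly (G + smult t F) z = 0 \<Longrightarrow> poly (pderiv (G + smult t F)) z \<noteq> 0"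
proof -
  define W where "W = F * pderiv G - pderiv F * G"
  have "W \<noteq> 0" unfolding W_def using assms by (intro wronskian_nonzero) auto
  then have fin: "finite {z. poly W z = 0}" by (rule poly_roots_finite)
  \<comment> \<open>The first excluded value would let the degree drop below \<open>q\<close>; the
    others are the parameters of the members vanishing at a root of the Wronskian.\<close>
  obtain t where t: "t \<notin> insert (- coeff G q / coeff F q) ((\<lambda>z. - poly G z / poly F z) ` {z. poly W z = 0})"
    using infinite_complex_avoid[of "insert (- coeff G q / coeff F q) ((\<lambda>z. - poly G z / poly F z) ` {z. poly W z = 0})"] fin
    by blast
  have "coeff G q \<noteq> 0" using assms by auto
  have "coeff (G + smult t F) q \<noteq> 0"
  proof (cases "coeff F q = 0")
    case False
    then show ?thesis using t by (auto simp: field_simps eq_neg_iff_add_eq_0 add.commute)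
  qed (use \<open>coeff G q \<noteq> 0\<close> in simp)
  moreover have "degree (G + smult t F) \<le> q"
    using assms by (intro degree_add_le) (auto intro: order.trans[OF degree_smult_le])
  ultimately have "degree (G + smult t F) = q" by (simp add: le_antisym le_degree)
  moreover have "poly (pderiv (G + smult t F)) z \<noteq> 0" if "poly (G + smult t F) z = 0" for z
  proof
    assume "poly (pderiv (G + smult t F)) z = 0"
    then have d: "poly (pderiv G) z = - t * poly (pderiv F) z"
      by (simp add: pderiv_add pderiv_smult eq_neg_iff_add_eq_0)
    have g: "poly G z = - t * poly F z" using that by (simp add: eq_neg_iff_add_eq_0)
    have "poly W z = 0" by (simp add: W_def d g)
    moreover have "poly F z \<noteq> 0" using assms(5)[of z] g by auto
    then have "t = - poly G z / poly F z" by (simp add: g)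
    ultimately show False using t by blast
  qed
  ultimately show ?thesis by (rule that)
qed

lemma exists_squarefree_annih:
  assumes "d = q + k" "q > 0" "no_annih d (Suc k) h"
  obtains a b where "gen_pos q a b" "annih d q (\<Prod>j<q. lin (a j) (b j)) h"
proof -
  note bpf = annih_base_point_free[OF assms(1,3)]
  obtain F where F: "annih d q F h" "form q F 1 0 \<noteq> 0" using bpf[of 1 0] by auto
  have "F \<noteq> 0" using F by (auto simp: form_def)
  have dF: "degree F \<le> q" using F by (simp add: annih_def)
  \<comment> \<open>Nonvanishing at (0, 1) forces \<open>G\<close> to have degree exactly
    \<open>q\<close>; nonvanishing at the roots of \<open>F\<close> excludes common roots.\<close>
  obtain G where G: "annih d q G h" "\<forall>(a, b)\<in>insert (0, 1) ((\<lambda>z. (1, z)) ` {z. poly F z = 0}). form q G a b \<noteq> 0"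
  proof -
    have "\<exists>G. annih d q G h \<and>
      (\<forall>(a, b)\<in>insert (0, 1) ((\<lambda>z. (1, z)) ` {z. poly F z = 0}). form q G a b \<noteq> 0)"
      using poly_roots_finite[OF \<open>F \<noteq> 0\<close>] by (intro annih_avoid_points bpf) auto
    then show ?thesis using that by blast
  qed
  have "degree G \<le> q" using G by (simp add: annih_def)
  moreover have "coeff G q \<noteq> 0" using G(2) by (simp add: form_0)
  ultimately have dG: "degree G = q" by (simp add: le_antisym le_degree)
  have FG: "poly G z \<noteq> 0" if "poly F z = 0" for z
    using G(2) that \<open>degree G \<le> q\<close> by (auto simp: form_1)
  obtain t where t: "degree (G + smult t F) = q"
    "\<And>z. poly (G + smult t F) z = 0 \<Longrightarrow> poly (pderiv (G + smult t F)) z \<noteq> 0"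
    using pencil_simple_roots[OF \<open>F \<noteq> 0\<close> dF dG assms(2) FG] by blast
  define R where "R = G + smult t F"
  have R: "annih d q R h" unfolding R_def by (intro annih_add annih_smult G F)
  have "R \<noteq> 0" using t assms(2) by (auto simp: R_def)
  then obtain c a b where f: "c \<noteq> 0" "\<And>j. j < q \<Longrightarrow> (a j, b j) \<noteq> (0, 0)"
    "R = smult c (\<Prod>j<q. lin (a j) (b j))"
    using form_factorization[of R q] t by (auto simp: R_def)
  have "gen_pos q a b"
  proof (rule ccontr)
    assume "\<not> gen_pos q a b"
    from not_gen_pos_square_factor[OF f(2) this]
    obtain x y p where p: "2 \<le> q" "(x, y) \<noteq> (0, 0)" "degree p \<le> q - 2"
      "(\<Prod>j<q. lin (a j) (b j)) = lin x y * lin x y * p" by blast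
    have Rp: "R = smult c (lin x y * lin x y * p)" using f p by simp
    \<comment> \<open>The square of the linear form of (0, 1) is a constant, so the degree would
      drop by two; any other square factor gives a root shared with the derivative.\<close>
    show False
    proof (cases "x = 0")
      case True
      then have "R = smult (c * y * y) p" by (simp add: Rp lin_def mult.assoc)
      then have "degree R \<le> q - 2" using p(3) degree_smult_le[of "c * y * y" p] by simp
      then show False using t p(1) by (simp add: R_def)
    next
      case False
      then have z: "poly (lin x y) (y / x) = 0" by (simp add: lin_def)
      then have "poly R (y / x) = 0" by (simp add: Rp)
      moreover have "poly (pderiv R) (y / x) = 0"
        by (simp add: Rp pderiv_smult pderiv_mult z)
      ultimately show False using t(2)[of "y / x"] by (simp add: R_def)
    qed
  qed
  moreover have "annih d q (\<Prod>j<q. lin (a j) (b j)) h"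
    using R f by (auto simp: annih_def act_smult)
  ultimately show ?thesis by (rule that)
qed

text \<open>The terms of a shortest representation are pairwise independent: vanishing terms can be
  dropped and proportional ones merged.\<close>

lemma shortest_vrep_gen_pos:
  assumes "d > 0" and h: "\<And>t. t \<le> d \<Longrightarrow> h t = (\<Sum>j<q. vm d (a j) (b j) t)"
    and min: "\<And>q'. vrep d q' h \<Longrightarrow> q \<le> q'"
  shows "gen_pos q a b"
proof -
  have nz: "(a j, b j) \<noteq> (0, 0)" if "j < q" for j
  proof
    assume z: "(a j, b j) = (0, 0)"
    have "h t = (\<Sum>i\<in>{..<q} - {j}. 1 * vm d (a i) (b i) t)" if "t \<le> d" for t
    proof -
      have "vm d (a j) (b j) t = 0" using z \<open>t \<le> d\<close> assms(1) by (auto simp: vm_def power_0_left)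
      then show ?thesis using h[OF that] sum.remove[of "{..<q}" j "\<lambda>i. vm d (a i) (b i) t"] \<open>j < q\<close> by simp
    qed
    then have "vrep d (card ({..<q} - {j})) h" by (rule vrepI[OF assms(1), rotated]) auto
    then show False using min[of "card ({..<q} - {j})"] that by simp
  qed
  have "a j * b k \<noteq> a k * b j" if jk: "j < q" "k < q" "j \<noteq> k" for j k
  proof
    assume par: "a j * b k = a k * b j"
    have "\<exists>l. a k = l * a j \<and> b k = l * b j"
    proof (cases "a j = 0")
      case True
      then have "b j \<noteq> 0" "a k = 0" using nz[OF jk(1)] par by auto
      then show ?thesis using True by (intro exI[of _ "b k / b j"]) auto
    next
      case False
      then show ?thesis using par by (intro exI[of _ "a k / a j"]) (auto simp: field_simps)
    qed
    then obtain l where l: "a k = l * a j" "b k = l * b j" by blast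
    have "h t = (\<Sum>i\<in>{..<q} - {k}. (if i = j then 1 + l ^ d else 1) * vm d (a i) (b i) t)" if "t \<le> d" for t
    proof -
      have v: "vm d (a k) (b k) t = l ^ d * vm d (a j) (b j) t"
        using that by (simp add: l vm_def power_mult_distrib flip: power_add)
      have "h t = vm d (a k) (b k) t + (\<Sum>i\<in>{..<q} - {k}. vm d (a i) (b i) t)"
        using h[OF that] sum.remove[of "{..<q}" k "\<lambda>i. vm d (a i) (b i) t"] jk by simp
      also have "(\<Sum>i\<in>{..<q} - {k}. vm d (a i) (b i) t)
        = vm d (a j) (b j) t + (\<Sum>i\<in>{..<q} - {k} - {j}. vm d (a i) (b i) t)"
        using jk by (intro sum.remove) auto
      also have "(\<Sum>i\<in>{..<q} - {k} - {j}. vm d (a i) (b i) t)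
        = (\<Sum>i\<in>{..<q} - {k} - {j}. (if i = j then 1 + l ^ d else 1) * vm d (a i) (b i) t)"
        by (intro sum.cong) auto
      also have "vm d (a k) (b k) t + (vm d (a j) (b j) t + \<dots>) =
        (if j = j then 1 + l ^ d else 1) * vm d (a j) (b j) t + \<dots>"
        by (simp add: v algebra_simps)
      also have "\<dots> = (\<Sum>i\<in>{..<q} - {k}. (if i = j then 1 + l ^ d else 1) * vm d (a i) (b i) t)"
        using jk by (intro sum.remove[symmetric]) auto
      finally show ?thesis .
    qed
    then have "vrep d (card ({..<q} - {k})) h" by (rule vrepI[OF assms(1), rotated]) auto
    then show False using min[of "card ({..<q} - {k})"] jk by simp
  qed
  with nz show ?thesis by (auto simp: gen_pos_def)
qed

text \<open>Multiplying \<open>p\<close> by the linear forms of all points except \<open>i\<close>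
  isolates the term of that point. The bound \<open>r + q \<le> Suc d\<close> keeps the product
  within degree \<open>d\<close>, so at least one equation is available.\<close>

lemma annih_vanishes_on_points:
  assumes h: "\<And>t. t \<le> d \<Longrightarrow> h t = (\<Sum>j<q. vm d (a j) (b j) t)"
    and gp: "gen_pos q a b" and p: "annih d r p h" and rq: "r + q \<le> Suc d" and i: "i < q"
  shows "form r p (a i) (b i) = 0"
proof -
  define J where "J = {..<q} - {i}"
  define L where "L = (\<Prod>j\<in>J. lin (a j) (b j))"
  define e where "e = card J + r"
  have J: "finite J" "Suc (card J) = q" using i by (auto simp: J_def)
  have dL: "degree L \<le> card J" unfolding L_def by (rule degree_prod_lin_le[OF J(1)])
  have dp: "degree p \<le> r" using p by (simp add: annih_def)
  have dT: "degree (L * p) \<le> e" unfolding e_def by (rule order.trans[OF degree_mult_le add_mono[OF dL dp]])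
  have e: "e \<le> d" using rq J by (simp add: e_def)
  have fT: "form e (L * p) (a k) (b k) = (if k = i then form e (L * p) (a i) (b i) else 0)" if "k < q" for k
  proof (cases "k = i")
    case False
    then have "k \<in> J" using that by (simp add: J_def)
    then have "(\<Prod>j\<in>J. b j * a k - a j * b k) = 0" using J by (intro prod_zero) (auto simp: mult.commute)
    then show ?thesis using False unfolding e_def L_def
      by (subst form_mult) (auto simp: form_prod_lin J dL[unfolded L_def] dp)
  qed simp
  have key: "form e (L * p) (a i) (b i) * vm (d - e) (a i) (b i) s = 0" if s: "s + e \<le> d" for s
  proof -
    have "act (L * p) h s = act L (act p h) s" by (simp add: act_mult)
    also have "\<dots> = act L (\<lambda>_. 0) s"
      by (rule act_cong[OF dL]) (use p s in \<open>auto simp: annih_def e_def\<close>)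
    also have "\<dots> = 0" by (simp add: act_def)
    finally have "0 = act (L * p) (\<lambda>t. \<Sum>j<q. 1 * vm d (a j) (b j) t) s"
      using act_cong[OF dT, of h s "\<lambda>t. \<Sum>j<q. 1 * vm d (a j) (b j) t"] h s by auto
    also have "\<dots> = (\<Sum>j<q. form e (L * p) (a j) (b j) * vm (d - e) (a j) (b j) s)"
      by (subst act_sum) (simp add: act_vm[OF dT s])
    also have "\<dots> = (\<Sum>j<q. if j = i then form e (L * p) (a i) (b i) * vm (d - e) (a i) (b i) s else 0)"
    proof (intro sum.cong refl)
      fix j assume "j \<in> {..<q}"
      then show "form e (L * p) (a j) (b j) * vm (d - e) (a j) (b j) s
        = (if j = i then form e (L * p) (a i) (b i) * vm (d - e) (a i) (b i) s else 0)"
        by (cases "j = i") (simp_all add: fT[of j])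
    qed
    also have "\<dots> = form e (L * p) (a i) (b i) * vm (d - e) (a i) (b i) s"
      using i by simp
    finally show ?thesis by simp
  qed
  have "(a i, b i) \<noteq> (0, 0)" using gp i by (auto simp: gen_pos_def)
  \<comment> \<open>The two extreme equations contain powers of \<open>a i\<close> and of
    \<open>b i\<close> respectively, and these do not both vanish.\<close>
  then have "form e (L * p) (a i) (b i) = 0"
    using key[of 0] key[of "d - e"] e by (auto simp: vm_def)
  then have "(\<Prod>j\<in>J. b j * a i - a j * b i) * form r p (a i) (b i) = 0"
    unfolding e_def L_def by (subst (asm) form_mult) (auto simp: form_prod_lin J dL[unfolded L_def] dp)
  moreover have "(\<Prod>j\<in>J. b j * a i - a j * b i) \<noteq> 0"
    using gp i J by (auto simp: gen_pos_def J_def mult.commute)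
  ultimately show ?thesis by simp
qed

lemma annih_prod_of_vrep:
  assumes "\<And>t. t \<le> d \<Longrightarrow> h t = (\<Sum>j<q. vm d (a j) (b j) t)"
  shows "annih d q (\<Prod>j<q. lin (a j) (b j)) h"
proof -
  define L where "L = (\<Prod>j<q. lin (a j) (b j))"
  have dL: "degree L \<le> q" using degree_prod_lin_le[of "{..<q}" a b] by (simp add: L_def)
  have "act L h s = 0" if "s + q \<le> d" for s
  proof -
    have "act L h s = act L (\<lambda>t. \<Sum>j<q. 1 * vm d (a j) (b j) t) s"
      using assms that by (intro act_cong[OF dL]) auto
    also have "\<dots> = (\<Sum>j<q. form q L (a j) (b j) * vm (d - q) (a j) (b j) s)"
      by (subst act_sum) (simp add: act_vm[OF dL that])
    also have "\<dots> = 0"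
    proof (intro sum.neutral ballI)
      fix k assume "k \<in> {..<q}"
      then have "(\<Prod>j<q. b j * a k - a j * b k) = 0" by (intro prod_zero) (auto simp: mult.commute)
      then show "form q L (a k) (b k) * vm (d - q) (a k) (b k) s = 0"
        using form_prod_lin[of "{..<q}" a b] by (simp add: L_def)
    qed
    finally show ?thesis .
  qed
  then show ?thesis using dL by (auto simp: annih_def L_def)
qed

section \<open>Minimal length of Vandermonde representations\<close>

lemma no_annih_mono:
  assumes "no_annih d r h" "r' \<le> r"
  shows "no_annih d r' h"
  using assms unfolding no_annih_def annih_def by (meson add_left_mono order.trans)

text \<open>The linear forms of the points in a shortest representation multiply to a nonzero
  annihilator, whose degree is its length.\<close>

lemma vrep_lower_bound:
  assumes "d > 0" "r \<ge> 1" "no_annih d (r - 1) h" "vrep d q h"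
  shows "r \<le> q"
proof (rule ccontr)
  assume "\<not> r \<le> q"
  then have "q \<le> r - 1" by simp
  define Q where "Q = (LEAST q. vrep d q h)"
  have Q: "vrep d Q h" "\<And>q'. vrep d q' h \<Longrightarrow> Q \<le> q'"
    unfolding Q_def using assms(4) by (auto intro: LeastI Least_le)
  obtain a b where ab: "\<And>t. t \<le> d \<Longrightarrow> h t = (\<Sum>j<Q. vm d (a j) (b j) t)"
    using Q(1) unfolding vrep_def by blast
  have gp: "gen_pos Q a b" by (rule shortest_vrep_gen_pos[OF assms(1) ab Q(2)])
  have "annih d Q (\<Prod>j<Q. lin (a j) (b j)) h" by (rule annih_prod_of_vrep[OF ab])
  moreover have "no_annih d Q h"
    using no_annih_mono[OF assms(3)] Q(2)[OF assms(4)] \<open>q \<le> r - 1\<close> by simp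
  ultimately have "(\<Prod>j<Q. lin (a j) (b j)) = 0" by (simp add: no_annih_def)
  then show False using gp by (auto simp: gen_pos_def prod_zero_iff)
qed

text \<open>At most one of the \<open>r\<close> distinct zeros can be the multiple root. The
  cofactor of degree \<open>r - 2\<close> then has at least \<open>r - 1\<close> zeros and
  vanishes.\<close>

lemma multiple_root_not_gen_pos:
  assumes "poly_of r f \<noteq> 0" "binform_multiple_root r f" "gen_pos r a b"
    "\<And>j. j < r \<Longrightarrow> form r (poly_of r f) (a j) (b j) = 0"
  shows False
proof -
  obtain x y g where r: "2 \<le> r" and xy: "(x, y) \<noteq> (0, 0)"
    and fac: "\<And>u v. form r (poly_of r f) u v = (y * u - x * v)\<^sup>2 * form (r - 2) (poly_of (r - 2) g) u v"
    using assms(2) unfolding binform_multiple_root_def form_poly_of by blast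
  define K where "K = {j. j < r \<and> y * a j - x * b j \<noteq> 0}"
  have one: "j = k" if "j < r" "k < r" "y * a j = x * b j" "y * a k = x * b k" for j k
  proof (rule ccontr)
    assume "j \<noteq> k"
    then have ne: "a j * b k - a k * b j \<noteq> 0" using assms(3) that by (auto simp: gen_pos_def)
    have "x * (a j * b k - a k * b j) = a j * (x * b k) - a k * (x * b j)" by (simp add: algebra_simps)
    also have "\<dots> = 0" by (simp add: that(3,4)[symmetric])
    finally have "x = 0" using ne by simp
    moreover have "y * (a j * b k - a k * b j) = (y * a j) * b k - (y * a k) * b j" by (simp add: algebra_simps)
    then have "y = 0" using ne by (simp add: that(3,4))
    ultimately show False using xy by simp
  qed
  have "card ({..<r} - K) \<le> 1"
  proof (rule card_le_Suc0_iff_eq[THEN iffD2, unfolded One_nat_def[symmetric]])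
    show "\<forall>j\<in>{..<r} - K. \<forall>k\<in>{..<r} - K. j = k" using one by (auto simp: K_def)
  qed simp
  moreover have "K \<subseteq> {..<r}" by (auto simp: K_def)
  ultimately have cK: "r - 1 \<le> card K" by (simp add: card_Diff_subset finite_subset)
  obtain e where e: "bij_betw e {..<card K} K"
    using ex_bij_betw_nat_finite[of K] \<open>K \<subseteq> {..<r}\<close> by (auto simp: atLeast0LessThan finite_subset)
  have eK: "e j \<in> K" if "j < card K" for j using e that by (auto simp: bij_betw_def)
  have inj: "e j \<noteq> e k" if "j < card K" "k < card K" "j \<noteq> k" for j k
    using e that by (auto simp: bij_betw_def inj_on_def)
  have "poly_of (r - 2) g = 0"
  proof (rule ccontr)
    assume "poly_of (r - 2) g \<noteq> 0"
    then have "card K \<le> r - 2"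
    proof (rule form_zeros_le[OF degree_poly_of])
      show "gen_pos (card K) (\<lambda>j. a (e j)) (\<lambda>j. b (e j))"
        using assms(3) eK inj by (auto simp: gen_pos_def K_def)
      fix j assume "j < card K"
      then show "form (r - 2) (poly_of (r - 2) g) (a (e j)) (b (e j)) = 0"
        using assms(4)[of "e j"] eK[of j] fac[of "a (e j)" "b (e j)"] by (auto simp: K_def)
    qed
    then show False using cK r by simp
  qed
  then have "poly (poly_of r f) v = 0" for v
    using fac[of 1 v] degree_poly_of[of r f] by (simp add: form_1[symmetric] form_def)
  then have "poly_of r f = 0" by (simp add: poly_all_0_iff_0[symmetric])
  with assms(1) show False by simp
qed

lemma not_multiple_root_gen_pos:
  assumes "poly_of r f \<noteq> 0" "\<not> binform_multiple_root r f"
  obtains c a b where "c \<noteq> 0" "gen_pos r a b" "poly_of r f = smult c (\<Prod>j<r. lin (a j) (b j))"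
proof -
  obtain c a b where f: "c \<noteq> 0" "\<And>j. j < r \<Longrightarrow> (a j, b j) \<noteq> (0, 0)"
    "poly_of r f = smult c (\<Prod>j<r. lin (a j) (b j))"
    using form_factorization[OF degree_poly_of assms(1)] by blast
  have "gen_pos r a b"
  proof (rule ccontr)
    assume "\<not> gen_pos r a b"
    from not_gen_pos_square_factor[OF f(2) this]
    obtain x y p where p: "2 \<le> r" "(x, y) \<noteq> (0, 0)" "degree p \<le> r - 2"
      "(\<Prod>j<r. lin (a j) (b j)) = lin x y * lin x y * p" by blast
    have dl: "degree (lin x y * lin x y) \<le> 2"
      using degree_mult_le[of "lin x y" "lin x y"] degree_lin_le[of x y] by simp
    have "form r (poly_of r f) u v = (y * u - x * v)\<^sup>2 * form (r - 2) (smult c p) u v" for u v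
    proof -
      have "form (2 + (r - 2)) (lin x y * lin x y * p) u v = form 2 (lin x y * lin x y) u v * form (r - 2) p u v"
        by (rule form_mult[OF dl p(3)])
      also have "form 2 (lin x y * lin x y) u v = form (1 + 1) (lin x y * lin x y) u v"
        by (simp add: numeral_2_eq_2)
      also have "\<dots> = (y * u - x * v)\<^sup>2"
        by (subst form_mult[OF degree_lin_le degree_lin_le]) (simp add: form_lin power2_eq_square)
      also have "2 + (r - 2) = r" using p(1) by simp
      finally show ?thesis using p f by (simp add: form_smult)
    qed
    then have "binform_multiple_root r f"
      unfolding binform_multiple_root_def form_poly_of using p(1,2)
      by (intro conjI exI[of _ x] exI[of _ y] exI[of _ "coeff (smult c p)"]) (auto simp: form_def)
    with assms(2) show False ..
  qed
  with f show ?thesis by (intro that)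
qed

lemma vrep_rank_simple:
  assumes "d > 0" "poly_of r f \<noteq> 0" "annih d r (poly_of r f) h" "\<not> binform_multiple_root r f"
  shows "vrep d r h"
proof -
  obtain c a b where f: "c \<noteq> 0" "gen_pos r a b" "poly_of r f = smult c (\<Prod>j<r. lin (a j) (b j))"
    using not_multiple_root_gen_pos[OF assms(2,4)] by blast
  show ?thesis by (rule vrep_of_annih[OF assms(1) f(2)]) (use assms(3) f in \<open>auto simp: annih_def act_smult\<close>)
qed

lemma vrep_rank_multiple:
  assumes "d > 0" "2 \<le> r" "2 * r \<le> d + 2" "poly_of r f \<noteq> 0" "annih d r (poly_of r f) h"
    "binform_multiple_root r f" "no_annih d (r - 1) h"
  shows "vrep d (d - r + 2) h" "\<And>q. vrep d q h \<Longrightarrow> d - r + 2 \<le> q"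
proof -
  \<comment> \<open>Degree \<open>d - r + 2\<close> is complementary to \<open>r - 2\<close>, so the
    required absence of annihilators is precisely the one in degree \<open>r - 1\<close>.\<close>
  have "d = (d - r + 2) + (r - 2)" using assms by simp
  moreover have "Suc (r - 2) = r - 1" using assms by simp
  ultimately obtain a b where "gen_pos (d - r + 2) a b" "annih d (d - r + 2) (\<Prod>j<d - r + 2. lin (a j) (b j)) h"
    using exists_squarefree_annih[of d "d - r + 2" "r - 2" h] assms by auto
  then show "vrep d (d - r + 2) h" by (rule vrep_of_annih[OF assms(1)])
  fix q assume q: "vrep d q h"
  define Q where "Q = (LEAST q. vrep d q h)"
  have Q: "vrep d Q h" "\<And>q'. vrep d q' h \<Longrightarrow> Q \<le> q'"
    unfolding Q_def using q by (auto intro: LeastI Least_le)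
  obtain a b where ab: "\<And>t. t \<le> d \<Longrightarrow> h t = (\<Sum>j<Q. vm d (a j) (b j) t)"
    using Q(1) unfolding vrep_def by blast
  have gp: "gen_pos Q a b" by (rule shortest_vrep_gen_pos[OF assms(1) ab Q(2)])
  have "r \<le> Q" by (rule vrep_lower_bound[OF assms(1) _ assms(7) Q(1)]) (use assms in simp)
  have "d - r + 2 \<le> Q"
  proof (rule ccontr)
    assume "\<not> d - r + 2 \<le> Q"
    then have "r + Q \<le> Suc d" using assms by simp
    then have z: "form r (poly_of r f) (a j) (b j) = 0" if "j < Q" for j
      using annih_vanishes_on_points[OF ab gp assms(5) _ that] by blast
    then have "Q \<le> r" by (rule form_zeros_le[OF degree_poly_of assms(4) gp])
    with \<open>r \<le> Q\<close> gp z show False using multiple_root_not_gen_pos[OF assms(4,6)] by auto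
  qed
  with Q(2)[OF q] show "d - r + 2 \<le> q" by simp
qed

section \<open>Ranks of catalecticants and flattenings\<close>

lemma (in vec_space) partial_comb_in_span:
  fixes k :: nat
  assumes "B \<subseteq> carrier_vec n" "\<And>i. i < k \<Longrightarrow> f i \<in> span B"
  shows "vec n (\<lambda>x. \<Sum>i<k. c i * f i $ x) \<in> span B"
  using assms(2)
proof (induction k)
  case 0
  have "vec n (\<lambda>x. \<Sum>i<0. c i * f i $ x) = 0\<^sub>v n" by auto
  then show ?case using vectorspace.span_zero[OF vec_vs, where U = B] by (simp add: module_vec_simps)
next
  case (Suc k)
  have fk: "f k \<in> carrier_vec n" using Suc.prems[of k] span_is_subset2[of B] assms(1) by auto
  have "vec n (\<lambda>x. \<Sum>i<Suc k. c i * f i $ x) = vec n (\<lambda>x. \<Sum>i<k. c i * f i $ x) + c k \<cdot>\<^sub>v f k"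
    using fk by (intro eq_vecI) auto
  also have "\<dots> \<in> span B"
    using span_add1[of B, OF _ Suc.IH smult_in_span[OF assms(1) Suc.prems]] Suc.prems assms(1) by simp
  finally show ?case .
qed

text \<open>A column is a pivot if no kernel vector has its last nonzero entry there; the other columns
  are combinations of earlier ones.\<close>

lemma mat_rank_le_pivots:
  assumes A: "A \<in> carrier_mat nr nc" and finP: "finite P"
    and np: "\<And>j. j < nc \<Longrightarrow> j \<notin> P \<Longrightarrow>
      \<exists>v\<in>carrier_vec nc. A *\<^sub>v v = 0\<^sub>v nr \<and> v $ j \<noteq> 0 \<and> (\<forall>i<nc. j < i \<longrightarrow> v $ i = 0)"
  shows "mat_rank A \<le> card P"
proof -
  interpret vec_space "TYPE(complex)" nr .
  define B where "B = col A ` (P \<inter> {..<nc})"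
  have finB: "finite B" using finP by (simp add: B_def)
  have B: "B \<subseteq> carrier_vec nr" using A by (auto simp: B_def)
  have col: "col A j \<in> span B" if "j < nc" for j
    using that
  proof (induction j rule: less_induct)
    case (less j)
    show ?case
    proof (cases "j \<in> P")
      case True
      then have "col A j \<in> B" using less.prems by (auto simp: B_def)
      then show ?thesis using in_own_span[of B] B by auto
    next
      case False
      obtain v where v: "v \<in> carrier_vec nc" "A *\<^sub>v v = 0\<^sub>v nr" "v $ j \<noteq> 0" "\<forall>i<nc. j < i \<longrightarrow> v $ i = 0"
        using np[OF less.prems False] by blast
      \<comment> \<open>The kernel relation is solved for its last column, leaving only earlier
        ones.\<close>
      have "col A j = vec nr (\<lambda>x. \<Sum>i<j. (- v $ i / v $ j) * col A i $ x)"
      proof (rule eq_vecI)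
        fix x assume "x < dim_vec (vec nr (\<lambda>x. \<Sum>i<j. (- v $ i / v $ j) * col A i $ x))"
        then have x: "x < nr" by simp
        have "0 = (A *\<^sub>v v) $ x" using v(2) x by simp
        also have "\<dots> = (\<Sum>i<nc. v $ i * col A i $ x)"
          using x A v(1) by (auto simp: scalar_prod_def atLeast0LessThan mult.commute intro!: sum.cong)
        also have "\<dots> = (\<Sum>i<Suc j. v $ i * col A i $ x)"
          using less.prems v(4) by (intro sum.mono_neutral_right) auto
        finally have "col A j $ x = - (\<Sum>i<j. v $ i * col A i $ x) / v $ j"
          using v(3) by (simp add: field_simps eq_neg_iff_add_eq_0)
        then show "col A j $ x = vec nr (\<lambda>x. \<Sum>i<j. (- v $ i / v $ j) * col A i $ x) $ x"
          using x by (simp add: sum_divide_distrib flip: sum_negf)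
      qed (use A in simp)
      also have "\<dots> \<in> span B"
        by (rule partial_comb_in_span[OF B]) (use less in auto)
      finally show ?thesis .
    qed
  qed
  have "set (cols A) \<subseteq> span B" using col A by (auto simp: cols_def)
  then have 1: "span (set (cols A)) \<subseteq> span B" using B by (intro span_subsetI)
  have "B \<subseteq> set (cols A)" using A by (auto simp: B_def cols_def)
  then have "span B \<subseteq> span (set (cols A))" by (rule span_is_monotone)
  with 1 have "span (set (cols A)) = span B" by blast
  then have "rank A = vectorspace.dim class_ring (span_vs B)" by (simp add: rank_def)
  also have "\<dots> \<le> card B"
  proof -
    have "\<exists>U. finite U \<and> maximal U (\<lambda>T. T \<subseteq> B \<and> lin_indpt T)"
      by (rule maximal_exists[of _ "card B" "{}"])
        (use finB in \<open>auto intro: finite_subset card_mono simp: lin_dep_def\<close>)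
    then obtain U where U: "maximal U (\<lambda>T. T \<subseteq> B \<and> lin_indpt T)" by blast
    then have "U \<subseteq> B" by (simp add: maximal_def)
    then show ?thesis using dim_span[of B U] B finB U by (simp add: card_mono)
  qed
  also have "\<dots> \<le> card (P \<inter> {..<nc})" unfolding B_def using finP by (intro card_image_le) simp
  also have "\<dots> \<le> card P" using finP by (intro card_mono) auto
  finally show ?thesis using A by (simp add: mat_rank_def)
qed

text \<open>As in Gaussian elimination, the number of degrees occurring in a space of polynomials is
  its dimension. Its cardinality is thus the nullity of the catalecticant for
  \<open>q \<le> d\<close>, obtained without dimension theory.\<close>

definition degs :: "nat \<Rightarrow> nat \<Rightarrow> (nat \<Rightarrow> complex) \<Rightarrow> nat set" where
  "degs d q h = {degree g | g. g \<noteq> 0 \<and> annih d q g h}"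

lemma degs_subset: "degs d q h \<subseteq> {..q}"
  by (auto simp: degs_def annih_def)

lemma finite_degs [simp]: "finite (degs d q h)"
  using degs_subset by (rule finite_subset) simp

lemma catalecticant_mult:
  assumes "v \<in> carrier_vec (q + 1)" "i \<le> p"
  shows "(catalecticant p q h *\<^sub>v v) $ i = (\<Sum>j\<le>q. v $ j * h (i + j))"
  using assms unfolding catalecticant_def
  by (auto simp: scalar_prod_def atLeast0LessThan lessThan_Suc_atMost mult.commute intro!: sum.cong)

text \<open>The coefficients of an annihilator of degree \<open>j\<close> form a kernel vector with
  last nonzero entry at \<open>j\<close>, so column \<open>j\<close> is not a pivot.\<close>

lemma mat_rank_catalecticant_le:
  assumes "s \<le> d"
  shows "mat_rank (catalecticant (d - s) s h) \<le> card ({..s} - degs d s h)"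
proof (rule mat_rank_le_pivots)
  show C: "catalecticant (d - s) s h \<in> carrier_mat (d - s + 1) (s + 1)"
    by (simp add: catalecticant_def)
  fix j assume "j < s + 1" "j \<notin> {..s} - degs d s h"
  then have "j \<in> degs d s h" by auto
  then obtain g where g: "degree g = j" "g \<noteq> 0" "annih d s g h" by (auto simp: degs_def)
  define v where "v = vec (s + 1) (coeff g)"
  have "catalecticant (d - s) s h *\<^sub>v v = 0\<^sub>v (d - s + 1)"
  proof (rule eq_vecI)
    fix i assume i: "i < dim_vec (0\<^sub>v (d - s + 1) :: complex vec)"
    then have "(catalecticant (d - s) s h *\<^sub>v v) $ i = (\<Sum>j\<le>s. coeff g j * h (i + j))"
      by (subst catalecticant_mult) (auto simp: v_def)
    also have "\<dots> = act g h i" using g by (subst act_bound[of g s]) (auto simp: annih_def)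
    also have "\<dots> = 0" using g(3) i assms by (auto simp: annih_def)
    finally show "(catalecticant (d - s) s h *\<^sub>v v) $ i = 0\<^sub>v (d - s + 1) $ i" using i by simp
  qed (use C in \<open>simp add: catalecticant_def\<close>)
  moreover have "v $ j \<noteq> 0" using g \<open>j < s + 1\<close> by (auto simp: v_def)
  moreover have "\<forall>i<s + 1. j < i \<longrightarrow> v $ i = 0" using g by (auto simp: v_def coeff_eq_0)
  ultimately show "\<exists>v\<in>carrier_vec (s + 1). catalecticant (d - s) s h *\<^sub>v v = 0\<^sub>v (d - s + 1) \<and>
      v $ j \<noteq> 0 \<and> (\<forall>i<s + 1. j < i \<longrightarrow> v $ i = 0)"
    by (intro bexI[of _ v]) (auto simp: v_def)
qed simp

lemma annih_shift:
  assumes "annih d q g h"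
  shows "annih d (Suc q) g h" "annih d (Suc q) (pCons 0 g) h"
proof -
  show "annih d (Suc q) g h" using assms by (auto simp: annih_def)
  have "degree (pCons 0 g) \<le> Suc q" using assms degree_pCons_le[of 0 g] by (auto simp: annih_def)
  then show "annih d (Suc q) (pCons 0 g) h" using assms by (auto simp: annih_def act_pCons)
qed

text \<open>Raising the nominal degree keeps every annihilator and adds its product with the
  variable. The old degrees survive, and one more than their maximum is new.\<close>

lemma card_degs_Suc:
  assumes "degs d q h \<noteq> {}"
  shows "card (degs d q h) < card (degs d (Suc q) h)"
proof (rule psubset_card_mono)
  define M where "M = Max (degs d q h)"
  have "M \<in> degs d q h" using assms by (simp add: M_def)
  then obtain g where g: "degree g = M" "g \<noteq> 0" "annih d q g h" by (auto simp: degs_def)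
  then have "Suc M \<in> degs d (Suc q) h"
    using annih_shift(2)[OF g(3)] unfolding degs_def by (intro CollectI exI[of _ "pCons 0 g"]) auto
  moreover have "Suc M \<notin> degs d q h"
  proof
    assume "Suc M \<in> degs d q h"
    then have "Suc M \<le> M" unfolding M_def by (intro Max_ge) auto
    then show False by simp
  qed
  moreover have "degs d q h \<subseteq> degs d (Suc q) h" using annih_shift(1) by (auto simp: degs_def)
  ultimately show "degs d q h \<subset> degs d (Suc q) h" by blast
qed simp

lemma card_degs_mono:
  assumes "degs d q h \<noteq> {}" "q \<le> s"
  shows "card (degs d q h) + (s - q) \<le> card (degs d s h)"
  using assms(2)
proof (induction s rule: dec_induct)
  case (step s)
  have "card (degs d q h) > 0" using assms(1) by (simp add: card_gt_0_iff)
  with step have "card (degs d s h) > 0" by linarith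
  then have "degs d s h \<noteq> {}" by auto
  then show ?case using card_degs_Suc[of d s h] step by simp
qed simp

text \<open>If annihilators exist in degree \<open>q\<close>, the nullity grows by at least
  \<open>s - q\<close> on the way to \<open>s\<close>, so \<open>q\<close> has at least as many
  pivots as \<open>s\<close>. Otherwise all \<open>q + 1\<close> columns are pivots, which suffices
  by \<open>r \<le> q + 1\<close>.\<close>

lemma pivots_ge_rank:
  assumes "s \<le> d" "r = mat_rank (catalecticant (d - s) s h)" "q \<le> s" "r \<le> q + 1"
  shows "r \<le> card ({..q} - degs d q h)"
proof (cases "degs d q h = {}")
  case False
  have "r \<le> card ({..s} - degs d s h)" using mat_rank_catalecticant_le[OF assms(1)] assms(2) by simp
  also have "\<dots> = s + 1 - card (degs d s h)" using degs_subset by (subst card_Diff_subset) auto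
  finally have "r \<le> s + 1 - (card (degs d q h) + (s - q))"
    using card_degs_mono[OF False assms(3)] by linarith
  moreover have "card ({..q} - degs d q h) = q + 1 - card (degs d q h)"
    using degs_subset by (subst card_Diff_subset) auto
  ultimately show ?thesis using assms(3) by linarith
qed (use assms in simp)

text \<open>In degree \<open>r - 1\<close> there are \<open>r\<close> columns and at least
  \<open>r\<close> pivots, which leaves no degree for an annihilator.\<close>

lemma no_annih_of_rank:
  assumes "s \<le> d" "r = mat_rank (catalecticant (d - s) s h)" "r \<le> s + 1" "r \<ge> 1"
  shows "no_annih d (r - 1) h"
proof -
  have "r \<le> card ({..r - 1} - degs d (r - 1) h)"
    using assms by (intro pivots_ge_rank[of s]) auto
  also have "\<dots> = r - card (degs d (r - 1) h)"
    using degs_subset assms by (subst card_Diff_subset) auto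
  finally have "card (degs d (r - 1) h) = 0" using assms(4) by arith
  then have "degs d (r - 1) h = {}" by simp
  then show ?thesis by (auto simp: no_annih_def degs_def)
qed

section \<open>Determinants and limits of matrices of low rank\<close>

lemma det_low_rank:
  fixes M U V :: "nat \<Rightarrow> nat \<Rightarrow> complex"
  assumes "\<rho> < r" "\<And>i j. i < r \<Longrightarrow> j < r \<Longrightarrow> M i j = (\<Sum>k<\<rho>. U i k * V k j)"
  shows "det (mat r r (\<lambda>(i, j). M i j)) = 0"
proof -
  \<comment> \<open>Padding with zero rows makes both factors square; row \<rho> of the second one
    is zero, so its determinant vanishes.\<close>
  define V' where "V' = mat r r (\<lambda>(k, j). if k < \<rho> then V k j else 0)"
  have "mat r r (\<lambda>(i, j). M i j) = mat r r (\<lambda>(i, k). U i k) * V'"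
  proof (rule eq_matI)
    fix i j assume "i < dim_row (mat r r (\<lambda>(i, k). U i k) * V')" "j < dim_col (mat r r (\<lambda>(i, k). U i k) * V')"
    then have ij: "i < r" "j < r" by (auto simp: V'_def)
    then have "(mat r r (\<lambda>(i, k). U i k) * V') $$ (i, j) = (\<Sum>k<r. U i k * (if k < \<rho> then V k j else 0))"
      by (simp add: V'_def scalar_prod_def atLeast0LessThan)
    also have "\<dots> = M i j" unfolding assms(2)[OF ij]
      using assms(1) by (intro sum.mono_neutral_cong_right) auto
    finally show "mat r r (\<lambda>(i, j). M i j) $$ (i, j) = (mat r r (\<lambda>(i, k). U i k) * V') $$ (i, j)"
      using ij by simp
  qed (auto simp: V'_def)
  also have "det \<dots> = det (mat r r (\<lambda>(i, k). U i k)) * det V'"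
    by (rule det_mult) (auto simp: V'_def)
  also have "det V' = 0"
  proof -
    have "(\<Prod>i = 0..<r. V' $$ (i, p i)) = 0" if "p permutes {0..<r}" for p
      using assms(1) permutes_in_image[OF that, of \<rho>]
      by (intro prod_zero) (auto simp: V'_def intro!: bexI[of _ \<rho>])
    moreover have "V' \<in> carrier_mat r r" by (simp add: V'_def)
    ultimately show ?thesis by (subst det_def'[of _ r]) (auto intro: sum.neutral)
  qed
  finally show ?thesis by simp
qed

lemma tendsto_det:
  fixes M :: "nat \<Rightarrow> nat \<Rightarrow> complex"
  assumes "\<And>i j. i < r \<Longrightarrow> j < r \<Longrightarrow> (\<lambda>t. X t i j) \<longlonglongrightarrow> M i j"
  shows "(\<lambda>t. det (mat r r (\<lambda>(i, j). X t i j))) \<longlonglongrightarrow> det (mat r r (\<lambda>(i, j). M i j))"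
proof -
  have d: "det (mat r r (\<lambda>(i, j). Y i j)) = (\<Sum>p | p permutes {0..<r}. signof p * (\<Prod>i = 0..<r. Y i (p i)))"
    for Y :: "nat \<Rightarrow> nat \<Rightarrow> complex"
    by (subst det_def'[of _ r]) (auto intro!: sum.cong prod.cong dest: permutes_in_image)
  show ?thesis unfolding d
    by (intro tendsto_sum tendsto_mult tendsto_const tendsto_prod assms)
      (auto dest: permutes_in_image)
qed

text \<open>The rank cannot drop in the limit: multiplying by the adjoint of an injective limit matrix
  gives square matrices whose determinants converge to a nonzero Gram determinant.\<close>

lemma limit_of_low_rank:
  fixes A :: "nat \<Rightarrow> nat \<Rightarrow> complex"
  assumes inj: "\<And>v. (\<forall>i<N. (\<Sum>j<r. A i j * v j) = 0) \<Longrightarrow> \<forall>j<r. v j = 0"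
    and lim: "\<And>i j. i < N \<Longrightarrow> j < r \<Longrightarrow> (\<lambda>t. X t i j) \<longlonglongrightarrow> A i j"
    and low: "\<And>t i j. i < N \<Longrightarrow> j < r \<Longrightarrow> X t i j = (\<Sum>k<\<rho>. U t i k * V t k j)"
  shows "r \<le> \<rho>"
proof (rule ccontr)
  assume "\<not> r \<le> \<rho>"
  then have \<rho>: "\<rho> < r" by simp
  define G where "G k l = (\<Sum>i<N. cnj (A i k) * A i l)" for k l
  define Gt where "Gt t k l = (\<Sum>i<N. cnj (A i k) * X t i l)" for t k l
  have "det (mat r r (\<lambda>(k, l). Gt t k l)) = 0" for t
  proof (rule det_low_rank[OF \<rho>])
    fix k l assume "k < r" "l < r"
    then have "Gt t k l = (\<Sum>i<N. \<Sum>j<\<rho>. cnj (A i k) * (U t i j * V t j l))"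
      by (auto simp: Gt_def low sum_distrib_left intro!: sum.cong)
    also have "\<dots> = (\<Sum>j<\<rho>. (\<Sum>i<N. cnj (A i k) * U t i j) * V t j l)"
      by (subst sum.swap) (simp add: sum_distrib_right mult.assoc)
    finally show "Gt t k l = (\<Sum>j<\<rho>. (\<Sum>i<N. cnj (A i k) * U t i j) * V t j l)" .
  qed
  moreover have "(\<lambda>t. det (mat r r (\<lambda>(k, l). Gt t k l))) \<longlonglongrightarrow> det (mat r r (\<lambda>(k, l). G k l))"
    unfolding Gt_def G_def by (intro tendsto_det tendsto_sum tendsto_mult tendsto_const lim) auto
  ultimately have "det (mat r r (\<lambda>(k, l). G k l)) = 0" by (simp add: LIMSEQ_const_iff)
  then obtain v where v: "v \<in> carrier_vec r" "v \<noteq> 0\<^sub>v r" "mat r r (\<lambda>(k, l). G k l) *\<^sub>v v = 0\<^sub>v r"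
    using det_0_iff_vec_prod_zero_field[of "mat r r (\<lambda>(k, l). G k l)" r] by auto
  have Gv: "(\<Sum>l<r. G k l * v $ l) = 0" if "k < r" for k
    using arg_cong[OF v(3), of "\<lambda>w. w $ k"] that v(1) by (simp add: scalar_prod_def atLeast0LessThan)
  \<comment> \<open>Here \<open>w\<close> is the image of the kernel vector \<open>v\<close> of the
    Gram matrix under \<open>A\<close>. Its squared norm is the Gram form at \<open>v\<close>, hence
    0.\<close>
  define w where "w i = (\<Sum>l<r. A i l * v $ l)" for i
  have "cnj (w i) = (\<Sum>k<r. cnj (v $ k) * cnj (A i k))" for i
    by (simp add: w_def mult.commute)
  then have "(\<Sum>i<N. cnj (w i) * w i) = (\<Sum>i<N. \<Sum>k<r. cnj (v $ k) * (cnj (A i k) * w i))"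
    by (simp add: sum_distrib_right mult.assoc)
  also have "\<dots> = (\<Sum>k<r. \<Sum>i<N. cnj (v $ k) * (cnj (A i k) * w i))" by (rule sum.swap)
  also have "\<dots> = (\<Sum>k<r. cnj (v $ k) * (\<Sum>l<r. G k l * v $ l))"
  proof (rule sum.cong[OF refl])
    fix k
    have "(\<Sum>i<N. cnj (A i k) * w i) = (\<Sum>l<r. \<Sum>i<N. cnj (A i k) * (A i l * v $ l))"
      unfolding w_def sum_distrib_left by (rule sum.swap)
    also have "\<dots> = (\<Sum>l<r. G k l * v $ l)" by (simp add: G_def sum_distrib_right mult.assoc)
    finally show "(\<Sum>i<N. cnj (v $ k) * (cnj (A i k) * w i)) = cnj (v $ k) * (\<Sum>l<r. G k l * v $ l)"
      by (simp flip: sum_distrib_left)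
  qed
  also have "\<dots> = 0" by (simp add: Gv)
  finally have "complex_of_real (\<Sum>i<N. (cmod (w i))\<^sup>2) = 0"
    by (simp only: of_real_sum complex_norm_square mult.commute)
  then have "(\<Sum>i<N. (cmod (w i))\<^sup>2) = 0" by (simp only: of_real_eq_0_iff)
  then have "\<forall>i<N. w i = 0" by (subst (asm) sum_nonneg_eq_0_iff) auto
  then have "\<forall>i<N. (\<Sum>l<r. A i l * v $ l) = 0" unfolding w_def .
  then have "\<forall>j<r. v $ j = 0" by (rule inj)
  then have "v = 0\<^sub>v r" using v(1) by (intro eq_vecI) auto
  with v(2) show False ..
qed

section \<open>Index tuples with prescribed sum and Hankel tensors\<close>

definition tup :: "nat \<Rightarrow> nat \<Rightarrow> nat \<Rightarrow> nat" where
  "tup n \<alpha> k = min (n - 1) (\<alpha> - k * (n - 1))"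

lemma tup_less: "n \<ge> 1 \<Longrightarrow> tup n \<alpha> k < n"
  by (simp add: tup_def)

text \<open>\<open>tup\<close> fills the slots greedily, each up to its capacity
  \<open>n - 1\<close>, until \<alpha> is used up or no slot is left.\<close>

lemma sum_tup: "(\<Sum>k<M. tup n \<alpha> k) = min \<alpha> (M * (n - 1))"
proof -
  have "(\<Sum>k<M. min N (\<alpha> - k * N)) = min \<alpha> (M * N)" for N
  proof (induction M)
    case (Suc M)
    then show ?case by (cases "\<alpha> \<le> M * N") auto
  qed simp
  then show ?thesis by (simp add: tup_def)
qed

lemma idx_sum_le:
  assumes "i \<in> idx m n"
  shows "(\<Sum>k<m. i k) \<le> (n - 1) * m"
proof -
  have "(\<Sum>k<m. i k) \<le> (\<Sum>k<m. n - 1)"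
    using assms by (intro sum_mono) (auto simp: idx_def)
  then show ?thesis by (simp add: mult.commute)
qed

lemma idx_with_sum:
  assumes "n \<ge> 1" "t \<le> (n - 1) * m"
  obtains i where "i \<in> idx m n" "(\<Sum>k<m. i k) = t"
proof (rule that[of "\<lambda>k. if k < m then tup n t k else 0"])
  show "(\<lambda>k. if k < m then tup n t k else 0) \<in> idx m n"
    using assms by (simp add: idx_def tup_less)
  have "(\<Sum>k<m. if k < m then tup n t k else 0) = (\<Sum>k<m. tup n t k)" by (intro sum.cong) auto
  then show "(\<Sum>k<m. if k < m then tup n t k else 0) = t"
    using assms by (simp add: sum_tup mult.commute)
qed

lemma vand_term:
  assumes "i \<in> idx m n"
  shows "(\<Prod>k<m. a ^ (n - 1 - i k) * b ^ i k) = vm ((n - 1) * m) a b (\<Sum>k<m. i k)"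
proof -
  have "(\<Sum>k<m. n - 1 - i k) + (\<Sum>k<m. i k) = (\<Sum>k<m. n - 1)"
    unfolding sum.distrib[symmetric] using assms by (intro sum.cong) (auto simp: idx_def)
  then have "(\<Sum>k<m. n - 1 - i k) = (n - 1) * m - (\<Sum>k<m. i k)" by (simp add: mult.commute)
  then show ?thesis by (simp add: vm_def prod.distrib power_sum[symmetric])
qed

text \<open>Every \<open>t\<close> up to \<open>(n - 1) * m\<close> is the sum of some admissible
  index, so the equations for the tensor and for its associated vector are the same.\<close>

lemma vand_decomp_hankel:
  assumes "n \<ge> 1"
  shows "vand_decomp m n (hankel_tensor m h) q \<longleftrightarrow> vrep ((n - 1) * m) q h"
proof -
  have "(\<forall>i\<in>idx m n. hankel_tensor m h i = (\<Sum>j<q. \<Prod>k<m. a j ^ (n - 1 - i k) * b j ^ i k)) \<longleftrightarrow>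
    (\<forall>t\<le>(n - 1) * m. h t = (\<Sum>j<q. vm ((n - 1) * m) (a j) (b j) t))"
    (is "?L \<longleftrightarrow> ?R") for a b
  proof
    assume L: ?L
    show ?R
    proof (intro allI impI)
      fix t assume "t \<le> (n - 1) * m"
      then obtain i where i: "i \<in> idx m n" "(\<Sum>k<m. i k) = t" using idx_with_sum[OF assms] by blast
      then show "h t = (\<Sum>j<q. vm ((n - 1) * m) (a j) (b j) t)"
        using L[rule_format, OF i(1)] by (simp only: hankel_tensor_def vand_term[OF i(1)] i(2))
    qed
  next
    assume R: ?R
    show ?L
    proof
      fix i assume i: "i \<in> idx m n"
      show "hankel_tensor m h i = (\<Sum>j<q. \<Prod>k<m. a j ^ (n - 1 - i k) * b j ^ i k)"
        using R idx_sum_le[OF i] by (simp only: hankel_tensor_def vand_term[OF i])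
    qed
  qed
  then show ?thesis unfolding vand_decomp_def vrep_def by simp
qed

lemma vand_imp_sym: "vand_decomp m n A q \<Longrightarrow> sym_decomp m n A q"
  unfolding vand_decomp_def sym_decomp_def
proof (elim exE)
  fix a b assume "\<forall>i\<in>idx m n. A i = (\<Sum>j<q. \<Prod>k<m. a j ^ (n - 1 - i k) * b j ^ i k)"
  then show "\<exists>v. \<forall>i\<in>idx m n. A i = (\<Sum>j<q. \<Prod>k<m. v j (i k))"
    by (intro exI[of _ "\<lambda>j x. a j ^ (n - 1 - x) * b j ^ x"])
qed

lemma sym_imp_cp: "sym_decomp m n A q \<Longrightarrow> cp_decomp m n A q"
  unfolding sym_decomp_def cp_decomp_def
proof (elim exE)
  fix v assume "\<forall>i\<in>idx m n. A i = (\<Sum>j<q. \<Prod>k<m. v j (i k))"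
  then show "\<exists>u. \<forall>i\<in>idx m n. A i = (\<Sum>j<q. \<Prod>k<m. u j k (i k))"
    by (intro exI[of _ "\<lambda>j _. v j"])
qed

lemma vand_decomp_cong:
  assumes "\<And>i. i \<in> idx m n \<Longrightarrow> A i = B i"
  shows "vand_decomp m n A q \<longleftrightarrow> vand_decomp m n B q"
  using assms by (simp add: vand_decomp_def)

lemma prod_split:
  fixes f :: "nat \<Rightarrow> 'a :: comm_monoid_mult"
  shows "(\<Prod>k<m + l. f k) = (\<Prod>k<m. f k) * (\<Prod>k<l. f (m + k))"
  by (induction l) (simp_all add: mult.assoc)

lemma sum_split:
  fixes f :: "nat \<Rightarrow> 'a :: comm_monoid_add"
  shows "(\<Sum>k<m + l. f k) = (\<Sum>k<m. f k) + (\<Sum>k<l. f (m + k))"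
  by (induction l) (simp_all add: add.assoc)

text \<open>Flattening along the first \<open>p\<close> and the last \<open>q\<close> factors turns a cp decomposition into a
  matrix factorization and the Hankel tensor into a catalecticant.\<close>

lemma cp_border_lower_bound:
  assumes n: "n \<ge> 1" and d: "d = (n - 1) * (p + q)"
    and pq: "(n - 1) * p \<le> s" "s \<le> d" and r: "r = mat_rank (catalecticant (d - s) s h)"
    and r_le: "r \<le> 1 + (n - 1) * p"
    and cp: "\<And>t. cp_decomp (p + q) n (X t) \<rho>"
    and lim: "tensor_limit (p + q) n X (hankel_tensor (p + q) h)"
  shows "r \<le> \<rho>"
proof -
  define c where "c = (n - 1) * p"
  have dc: "d - c = (n - 1) * q" "c \<le> d" using d by (simp_all add: c_def add_mult_distrib2)
  have "r \<le> card ({..c} - degs d c h)"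
    using pq r r_le by (intro pivots_ge_rank[of s]) (auto simp: c_def)
  \<comment> \<open>The chosen \<open>r\<close> pivot columns will be independent, because a
    relation between them is an annihilator whose degree lies in \<open>P\<close>.\<close>
  then obtain P where P: "P \<subseteq> {..c} - degs d c h" "card P = r"
    using obtain_subset_with_card_n by metis
  then have finP: "finite P" by (meson finite_Diff finite_atMost finite_subset)
  obtain e where e: "bij_betw e {..<r} P"
    using ex_bij_betw_nat_finite[OF finP] P(2) by (auto simp: atLeast0LessThan)
  have eP: "e j \<in> P" if "j < r" for j using e that by (auto simp: bij_betw_def)
  have ec: "e j \<le> c" if "j < r" for j using eP[OF that] P(1) by auto
  \<comment> \<open>The first \<open>p\<close> indices add up to the column number \<alpha> and the
    last \<open>q\<close> to the row number \<beta>, so the Hankel entry at this index is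
    \<open>h (\<beta> + \<alpha>)\<close>.\<close>
  define J where "J \<beta> \<alpha> k = (if k < p then tup n \<alpha> k else if k < p + q then tup n \<beta> (k - p) else 0)"
    for \<alpha> \<beta> k :: nat
  have J: "J \<beta> \<alpha> \<in> idx (p + q) n" for \<alpha> \<beta> using n by (simp add: J_def idx_def tup_less)
  have sumJ: "(\<Sum>k<p + q. J \<beta> \<alpha> k) = \<beta> + \<alpha>" if "\<alpha> \<le> c" "\<beta> \<le> d - c" for \<alpha> \<beta>
  proof -
    have "(\<Sum>k<p. J \<beta> \<alpha> k) = (\<Sum>k<p. tup n \<alpha> k)" by (intro sum.cong) (auto simp: J_def)
    moreover have "(\<Sum>k<q. J \<beta> \<alpha> (p + k)) = (\<Sum>k<q. tup n \<beta> k)" by (intro sum.cong) (auto simp: J_def)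
    ultimately show ?thesis using that dc by (simp add: sum_split sum_tup c_def mult.commute)
  qed
  have "\<forall>t. \<exists>u. \<forall>i\<in>idx (p + q) n. X t i = (\<Sum>j<\<rho>. \<Prod>k<p + q. u j k (i k))"
    using cp unfolding cp_decomp_def by blast
  from choice[OF this] obtain u
    where u: "\<And>t i. i \<in> idx (p + q) n \<Longrightarrow> X t i = (\<Sum>j<\<rho>. \<Prod>k<p + q. u t j k (i k))"
    by blast
  show ?thesis
  proof (rule limit_of_low_rank)
    fix v :: "nat \<Rightarrow> complex"
    assume v: "\<forall>i<Suc (d - c). (\<Sum>j<r. h (i + e j) * v j) = 0"
    define g where "g = (\<Sum>j<r. monom (v j) (e j))"
    have co: "coeff g l = (\<Sum>j<r. if e j = l then v j else 0)" for l by (simp add: g_def coeff_sum)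
    have coP: "l \<in> P" if "coeff g l \<noteq> 0" for l
    proof (rule ccontr)
      assume "l \<notin> P"
      then have "coeff g l = 0" unfolding co using eP by (intro sum.neutral) auto
      with that show False ..
    qed
    have dg: "degree g \<le> c"
    proof (rule degree_le, intro allI impI, rule ccontr)
      fix l assume "c < l" "coeff g l \<noteq> 0"
      then show False using coP[of l] P(1) by auto
    qed
    have "act g h i = (\<Sum>j<r. h (i + e j) * v j)" if "i \<le> d - c" for i
    proof -
      have "act g h i = (\<Sum>l\<le>c. \<Sum>j<r. if e j = l then v j * h (i + l) else 0)"
        unfolding act_bound[OF dg] co sum_distrib_right by (intro sum.cong refl) auto
      also have "\<dots> = (\<Sum>j<r. \<Sum>l\<le>c. if e j = l then v j * h (i + l) else 0)" by (rule sum.swap)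
      also have "\<dots> = (\<Sum>j<r. h (i + e j) * v j)"
        using ec by (intro sum.cong refl) (simp add: sum.delta')
      finally show ?thesis .
    qed
    then have ann: "annih d c g h" using v dg by (auto simp: annih_def)
    have "g = 0"
    proof (rule ccontr)
      assume "g \<noteq> 0"
      then have "degree g \<in> degs d c h" using ann by (auto simp: degs_def)
      moreover have "degree g \<in> P" using \<open>g \<noteq> 0\<close> by (intro coP) simp
      ultimately show False using P(1) by auto
    qed
    show "\<forall>j<r. v j = 0"
    proof (intro allI impI)
      fix j assume j: "j < r"
      have "coeff g (e j) = (\<Sum>l<r. if l = j then v l else 0)"
        unfolding co using e j by (intro sum.cong) (auto simp: bij_betw_def inj_on_def)
      then show "v j = 0" using j \<open>g = 0\<close> by simp
    qed
  next
    fix i j assume ij: "i < Suc (d - c)" "j < r"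
    then have "(\<lambda>t. X t (J i (e j))) \<longlonglongrightarrow> hankel_tensor (p + q) h (J i (e j))"
      using lim J by (auto simp: tensor_limit_def)
    then show "(\<lambda>t. X t (J i (e j))) \<longlonglongrightarrow> h (i + e j)"
      using ij ec by (simp add: hankel_tensor_def sumJ)
  next
    fix t i j assume "i < Suc (d - c)" "j < r"
    have "X t (J i (e j)) = (\<Sum>l<\<rho>. (\<Prod>k<p. u t l k (J i (e j) k)) * (\<Prod>k<q. u t l (p + k) (J i (e j) (p + k))))"
      unfolding u[OF J] prod_split ..
    also have "\<dots> = (\<Sum>l<\<rho>. (\<Prod>k<q. u t l (p + k) (tup n i k)) * (\<Prod>k<p. u t l k (tup n (e j) k)))"
      by (intro sum.cong refl) (simp add: J_def mult.commute)
    finally show "X t (J i (e j)) =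
      (\<Sum>l<\<rho>. (\<Prod>k<q. u t l (p + k) (tup n i k)) * (\<Prod>k<p. u t l k (tup n (e j) k)))" .
  qed
qed

section \<open>Ranks and border ranks of Hankel tensors of odd order\<close>

theorem theorem4p5:
  fixes m m0 n :: nat and h :: "nat \<Rightarrow> complex" and fv :: "complex vec"
  defines "d \<equiv> (n - 1) * m"
  defines "s \<equiv> d div 2"
  defines "H \<equiv> hankel_tensor m h"
  defines "r \<equiv> mat_rank (catalecticant (d - s) s h)"
  assumes m_odd: "m = 2 * m0 + 1"
    and n2: "n \<ge> 2"
    and f_ker: "fv \<in> mat_kernel (catalecticant (d - r) r h)"
    and f_nz: "fv \<noteq> 0\<^sub>v (r + 1)"
    and r_le: "r \<le> 1 + (n - 1) * m0"
  shows "(\<not> binform_multiple_root r (\<lambda>j. fv $ j) \<longrightarrow>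
           vand_rank m n H = r \<and> sym_rank m n H = r \<and> cp_rank m n H = r \<and>
           vand_border_rank m n H = r \<and> sym_border_rank m n H = r \<and> border_rank m n H = r)
       \<and> (binform_multiple_root r (\<lambda>j. fv $ j) \<longrightarrow>
           vand_rank m n H = d - r + 2 \<and> vand_rank m n H \<ge> sym_rank m n H \<and>
           sym_rank m n H \<ge> vand_border_rank m n H \<and>
           vand_border_rank m n H = r \<and> sym_border_rank m n H = r \<and> border_rank m n H = r)"
proof -
  have m: "m = m0 + (m0 + 1)" and n1: "n \<ge> 1" using m_odd n2 by auto
  \<comment> \<open>The extra summand \<open>n - 1\<close>, which is positive, comes from
    \<open>m\<close> being odd and turns \<open>r_le\<close> into the bounds on \<open>r\<close>
    below.\<close>
  have d: "d = (n - 1) * m0 + ((n - 1) * m0 + (n - 1))" by (simp add: d_def m algebra_simps)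
  have d0: "d > 0" using d n2 by simp
  have rd: "r \<le> d" using r_le d n2 by linarith
  have sd: "s \<le> d" "(n - 1) * m0 \<le> s" using d by (simp_all add: s_def)
  have r2: "2 * r \<le> d + 2" using r_le d n2 by linarith
  have rs: "r \<le> s + 1" using r_le sd by linarith
  define f where "f = (\<lambda>j. fv $ j)"
  have C: "catalecticant (d - r) r h \<in> carrier_mat (d - r + 1) (r + 1)" by (simp add: catalecticant_def)
  have fv: "fv \<in> carrier_vec (r + 1)" and Cf: "catalecticant (d - r) r h *\<^sub>v fv = 0\<^sub>v (d - r + 1)"
    using mat_kernelD[OF C f_ker] by auto
  have p0: "poly_of r f \<noteq> 0"
  proof
    assume "poly_of r f = 0"
    then have "fv $ j = 0" if "j \<le> r" for j
      using that coeff_poly_of[of r f j] by (simp add: f_def)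
    then have "fv = 0\<^sub>v (r + 1)" using fv by (intro eq_vecI) auto
    with f_nz show False ..
  qed
  have ann: "annih d r (poly_of r f) h"
    unfolding annih_def
  proof (intro conjI allI impI)
    fix i assume "i + r \<le> d"
    then have i: "i \<le> d - r" by simp
    have "act (poly_of r f) h i = (catalecticant (d - r) r h *\<^sub>v fv) $ i"
      by (simp add: catalecticant_mult[OF fv i] act_poly_of f_def)
    then show "act (poly_of r f) h i = 0" using Cf i by simp
  qed (rule degree_poly_of)
  have vd: "vand_decomp m n (hankel_tensor m g) q \<longleftrightarrow> vrep d q g" for g q
    unfolding d_def by (rule vand_decomp_hankel[OF n1])
  have lower: "r \<le> \<rho>" if "\<And>t. cp_decomp m n (X t) \<rho>" "tensor_limit m n X H" for X \<rho>
    by (rule cp_border_lower_bound[of n d m0 "m0 + 1" s r h X \<rho>])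
      (use n1 d_def sd r_le that in \<open>auto simp: m r_def H_def\<close>)
  \<comment> \<open>An exact decomposition is a border decomposition along the constant
    sequence.\<close>
  have lower_cp: "r \<le> \<rho>" if "cp_decomp m n H \<rho>" for \<rho>
    by (rule lower[of "\<lambda>_. H"]) (use that in \<open>auto simp: tensor_limit_def\<close>)
  obtain g where g: "\<And>t :: nat. vrep d r (g t)" "\<And>i. i \<le> d \<Longrightarrow> (\<lambda>t. g t i) \<longlonglongrightarrow> h i"
    using vrep_approximation[OF d0 p0 ann] by blast
  \<comment> \<open>This one sequence of Vandermonde sums gives the upper bound for all three border
    ranks.\<close>
  define X where "X t = hankel_tensor m (g t)" for t
  have XV: "vand_decomp m n (X t) r" for t using g(1) by (simp add: X_def vd)
  have XH: "tensor_limit m n X H"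
    unfolding tensor_limit_def X_def H_def hankel_tensor_def d_def
    using g(2) idx_sum_le[of _ m n] by (auto simp: d_def)
  have border: "border_rank m n H = r"
    unfolding border_rank_def
  proof (rule Least_equality)
    show "\<exists>X. (\<forall>t. cp_decomp m n (X t) r) \<and> tensor_limit m n X H"
      using XV XH by (blast intro: vand_imp_sym sym_imp_cp)
  qed (use lower in blast)
  have sym_border: "sym_border_rank m n H = r"
    unfolding sym_border_rank_def
  proof (rule Least_equality)
    show "\<exists>X. (\<forall>t. sym_decomp m n (X t) r) \<and> tensor_limit m n X H"
      using XV XH by (blast intro: vand_imp_sym)
  qed (use lower sym_imp_cp in blast)
  have vand_border: "vand_border_rank m n H = r"
    unfolding vand_border_rank_def
  proof (rule Least_equality)
    have "vand_rank m n (X t) \<le> r" for t unfolding vand_rank_def by (rule Least_le[of _ r]) (rule XV)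
    then show "\<exists>X. (\<forall>t. (\<exists>h. \<forall>i\<in>idx m n. X t i = hankel_tensor m h i) \<and> vand_rank m n (X t) \<le> r) \<and>
      tensor_limit m n X H"
      using XH by (intro exI[of _ X]) (auto simp: X_def)
  next
    fix \<rho>
    assume "\<exists>X. (\<forall>t. (\<exists>h. \<forall>i\<in>idx m n. X t i = hankel_tensor m h i) \<and> vand_rank m n (X t) \<le> \<rho>) \<and>
      tensor_limit m n X H"
    then obtain Y where Y: "\<And>t. \<exists>h. \<forall>i\<in>idx m n. Y t i = hankel_tensor m h i"
      "\<And>t. vand_rank m n (Y t) \<le> \<rho>" "tensor_limit m n Y H" by blast
    have "cp_decomp m n (Y t) \<rho>" for t
    proof -
      obtain k where k: "\<And>i. i \<in> idx m n \<Longrightarrow> Y t i = hankel_tensor m k i" using Y(1) by blast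
      have eq: "vand_decomp m n (Y t) q \<longleftrightarrow> vrep d q k" for q
        unfolding vd[symmetric] using k by (rule vand_decomp_cong)
      \<comment> \<open>A bound on \<open>vand_rank\<close> yields a decomposition only once some
        decomposition is known to exist; \<open>vrep_Suc\<close> supplies it, and zero terms then
        pad it to \<rho>.\<close>
      have "vrep d (vand_rank m n (Y t)) k"
        unfolding vand_rank_def eq using vrep_Suc[OF d0, of k] by (rule LeastI)
      then have "vand_decomp m n (Y t) \<rho>" using vrep_mono[OF d0 _ Y(2)] eq by blast
      then show ?thesis by (intro sym_imp_cp vand_imp_sym)
    qed
    then show "r \<le> \<rho>" using lower Y(3) by blast
  qed
  have vand_rank_eq: "vand_rank m n H = q" if "vrep d q h" "\<And>q'. vrep d q' h \<Longrightarrow> q \<le> q'" for q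
    unfolding vand_rank_def H_def vd using that by (rule Least_equality)
  have sym_ge: "sym_decomp m n H \<rho> \<Longrightarrow> r \<le> \<rho>" for \<rho> using lower_cp sym_imp_cp by blast
  show ?thesis
  proof (intro conjI impI border sym_border vand_border)
    assume nm: "\<not> binform_multiple_root r (\<lambda>j. fv $ j)"
    have rep: "vrep d r h" using vrep_rank_simple[OF d0 p0 ann] nm by (simp add: f_def)
    then have V: "vand_decomp m n H r" by (simp add: H_def vd)
    show "vand_rank m n H = r"
    proof (rule vand_rank_eq[OF rep])
      fix q assume "vrep d q h"
      then have "vand_decomp m n H q" by (simp add: H_def vd)
      then show "r \<le> q" by (intro lower_cp sym_imp_cp vand_imp_sym)
    qed
    show "sym_rank m n H = r" unfolding sym_rank_def
      using vand_imp_sym[OF V] sym_ge by (rule Least_equality)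
    show "cp_rank m n H = r" unfolding cp_rank_def
      using sym_imp_cp[OF vand_imp_sym[OF V]] lower_cp by (rule Least_equality)
  next
    assume mr: "binform_multiple_root r (\<lambda>j. fv $ j)"
    then have "2 \<le> r" by (simp add: binform_multiple_root_def)
    then have na: "no_annih d (r - 1) h" using no_annih_of_rank[OF sd(1) _ rs] by (simp add: r_def)
    have mr': "binform_multiple_root r f" using mr by (simp add: f_def)
    note vr = vrep_rank_multiple[OF d0 \<open>2 \<le> r\<close> r2 p0 ann mr' na]
    show vrank: "vand_rank m n H = d - r + 2" by (rule vand_rank_eq[OF vr])
    have S: "sym_decomp m n H (d - r + 2)" using vr(1) by (intro vand_imp_sym) (simp add: H_def vd)
    show "sym_rank m n H \<le> vand_rank m n H"
      unfolding vrank sym_rank_def using S by (rule Least_le)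
    have "sym_decomp m n H (sym_rank m n H)" unfolding sym_rank_def using S by (rule LeastI)
    then show "vand_border_rank m n H \<le> sym_rank m n H" unfolding vand_border by (rule sym_ge)
  qed
qed

end
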